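(* Let $a\in(0,1)$, $s\ge 2$, $r_1,r_2>2$, and let $u\in C([0,T];\mathrm{Z}^s_{r_1,r_2})$ be a solution of the IVP $$u_t+D_x^{a+1}\partial_x u+u_{xyy}+uu_x=0,\qquad u(x,y,0)=\phi(x,y),\quad (x,y)\in\mathbb R^2.$$ If there exist two different times $t_1,t_2\in[0,T]$ such that $u(t_j)\in \mathrm{Z}^s_{5/2+a,r_2}$, $j=1,2$, then $\hat u(0,\eta,t)=0$ for every $\eta\in\mathbb R$ and every $t\in[0,T]$.
   Context: $D_x^{a+1}$ is the Fourier multiplier $|\xi|^{a+1}$ in the $x$-variable, and $\hat u(\xi,\eta,t)$ denotes the Fourier transform of $u(\cdot,\cdot,t)$ in $(x,y)$, $\hat f(\xi,\eta)=\int e^{-i(x\xi+y\eta)}f(x,y)\,dxdy$. $H^{s_1,s_2}(\mathbb R^2)$ is the anisotropic Sobolev space with norm $\|f\|^2+\|J_x^{s_1}f\|^2+\|J_y^{s_2}f\|^2$ ($L^2$ norms, $J_x^{z},J_y^z$ the multipliers $(1+\xi^2)^{z/2}$, $(1+\eta^2)^{z/2}$). $L^2_{r_1,r_2}$ is the weighted space with norm $\left(\int(1+|x|^{2r_1}+|y|^{2r_2})|f|^2dxdy\right)^{1/2}$, and $\mathrm{Z}^s_{r_1,r_2}=H^{(1+a)s,2s}(\mathbb R^2)\cap L^2_{r_1,r_2}$. *)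

theory Defs
  imports "HOL-Analysis.Analysis"
begin

text \<open>Fourier transform in (x,y): hat f (xi,eta) = integral of e^{-i(x xi + y eta)} f(x,y).
  (Used only for functions in the weighted spaces below, which are integrable.)\<close>
definition fourier2 :: "(real \<times> real \<Rightarrow> real) \<Rightarrow> real \<Rightarrow> real \<Rightarrow> complex" where
  "fourier2 f \<xi> \<eta> =
     (LINT p|lborel. cis (- (fst p * \<xi> + snd p * \<eta>)) * complex_of_real (f p))"

text \<open>Anisotropic Sobolev space H^{s1,s2}: f in L^2 with J_x^{s1} f, J_y^{s2} f in L^2
  (expressed on the Fourier side via Plancherel).\<close>
definition Hsob :: "real \<Rightarrow> real \<Rightarrow> (real \<times> real \<Rightarrow> real) set" where
  "Hsob s1 s2 = {f. f \<in> borel_measurable lborel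
      \<and> integrable lborel (\<lambda>p. (f p)\<^sup>2)
      \<and> integrable lborel (\<lambda>q. (1 + (fst q)\<^sup>2) powr s1 * (cmod (fourier2 f (fst q) (snd q)))\<^sup>2)
      \<and> integrable lborel (\<lambda>q. (1 + (snd q)\<^sup>2) powr s2 * (cmod (fourier2 f (fst q) (snd q)))\<^sup>2)}"

definition Hsob_norm2 :: "real \<Rightarrow> real \<Rightarrow> (real \<times> real \<Rightarrow> real) \<Rightarrow> real" where
  "Hsob_norm2 s1 s2 f =
     (LINT p|lborel. (f p)\<^sup>2)
     + (1 / (2 * pi)\<^sup>2) * (LINT q|lborel. (1 + (fst q)\<^sup>2) powr s1 * (cmod (fourier2 f (fst q) (snd q)))\<^sup>2)
     + (1 / (2 * pi)\<^sup>2) * (LINT q|lborel. (1 + (snd q)\<^sup>2) powr s2 * (cmod (fourier2 f (fst q) (snd q)))\<^sup>2)"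

definition weightL2 :: "real \<Rightarrow> real \<Rightarrow> (real \<times> real \<Rightarrow> real) set" where
  "weightL2 r1 r2 = {f. f \<in> borel_measurable lborel
      \<and> integrable lborel (\<lambda>p. (1 + \<bar>fst p\<bar> powr (2 * r1) + \<bar>snd p\<bar> powr (2 * r2)) * (f p)\<^sup>2)}"

definition weightL2_norm2 :: "real \<Rightarrow> real \<Rightarrow> (real \<times> real \<Rightarrow> real) \<Rightarrow> real" where
  "weightL2_norm2 r1 r2 f =
     (LINT p|lborel. (1 + \<bar>fst p\<bar> powr (2 * r1) + \<bar>snd p\<bar> powr (2 * r2)) * (f p)\<^sup>2)"

definition Zspace :: "real \<Rightarrow> real \<Rightarrow> real \<Rightarrow> real \<Rightarrow> (real \<times> real \<Rightarrow> real) set" where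
  "Zspace a s r1 r2 = Hsob ((1 + a) * s) (2 * s) \<inter> weightL2 r1 r2"

definition Znorm :: "real \<Rightarrow> real \<Rightarrow> real \<Rightarrow> real \<Rightarrow> (real \<times> real \<Rightarrow> real) \<Rightarrow> real" where
  "Znorm a s r1 r2 f = sqrt (Hsob_norm2 ((1 + a) * s) (2 * s) f + weightL2_norm2 r1 r2 f)"

definition in_CZ :: "real \<Rightarrow> real \<Rightarrow> real \<Rightarrow> real \<Rightarrow> real \<Rightarrow> (real \<Rightarrow> real \<times> real \<Rightarrow> real) \<Rightarrow> bool" where
  "in_CZ a s r1 r2 T u \<longleftrightarrow>
     (\<forall>t\<in>{0..T}. u t \<in> Zspace a s r1 r2) \<and>
     (\<forall>t0\<in>{0..T}. ((\<lambda>t. Znorm a s r1 r2 (\<lambda>p. u t p - u t0 p)) \<longlongrightarrow> 0) (at t0 within {0..T}))"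

text \<open>u solves u_t + D_x^{a+1} u_x + u_xyy + u u_x = 0, u(0) = phi on [0,T], in the
  Fourier-side sense: for every frequency (xi,eta), t \<mapsto> hat u(xi,eta,t) is differentiable
  on [0,T] and
    d/dt hat u = -(i xi |xi|^{a+1} - i xi eta^2) hat u - (i xi / 2) hat(u^2).\<close>
definition solves_IVP :: "real \<Rightarrow> real \<Rightarrow> (real \<times> real \<Rightarrow> real) \<Rightarrow> (real \<Rightarrow> real \<times> real \<Rightarrow> real) \<Rightarrow> bool" where
  "solves_IVP a T \<phi> u \<longleftrightarrow>
     u 0 = \<phi> \<and>
     (\<forall>\<xi> \<eta>. \<forall>t\<in>{0..T}.
        ((\<lambda>\<tau>. fourier2 (u \<tau>) \<xi> \<eta>) has_vector_derivative
          (- (\<i> * complex_of_real (\<xi> * \<bar>\<xi>\<bar> powr (a + 1)) - \<i> * complex_of_real (\<xi> * \<eta>\<^sup>2))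
               * fourier2 (u t) \<xi> \<eta>
           - (\<i> * complex_of_real (\<xi> / 2)) * fourier2 (\<lambda>p. (u t p)\<^sup>2) \<xi> \<eta>))
        (at t within {0..T}))"

end

theory Submission
  imports Defs
begin

text \<open>Let \<open>v = exp (- i \<xi> \<eta>\<^sup>2 t) * fourier2 (u t) \<xi> \<eta>\<close>, so that
  \<open>v\<^sub>t = - i \<xi> \<bar>\<xi>\<bar> powr (1 + a) * v - (i \<xi> / 2) * exp (- i \<xi> \<eta>\<^sup>2 t) * fourier2 (u\<^sup>2)\<close>, and take the odd third
  difference of \<open>v\<close> in \<open>\<xi>\<close> at \<open>0\<close> with step \<open>l\<close>. The factor \<open>\<xi> \<bar>\<xi>\<bar> powr (1 + a)\<close> contributes
  \<open>\<kappa> l powr (2 + a) * (fourier2 (u t) 0 \<eta> + o(1))\<close> with \<open>\<kappa> \<noteq> 0\<close>, while the nonlinear term is \<open>O(l\<^sup>3)\<close> because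
  \<open>x\<^sup>2 u\<^sup>2\<close> is integrable. At the two times \<open>t1\<close>, \<open>t2\<close> the decay \<open>\<bar>x\<bar> powr (5/2 + a) * u \<in> L\<^sup>2\<close> makes the
  third difference, averaged over an interval of \<open>\<eta>\<close>, \<open>o(l powr (2 + a))\<close>. Since
  \<open>fourier2 (u t) 0 \<eta>\<close> does not depend on \<open>t\<close>, integrating in time from \<open>t1\<close> to \<open>t2\<close> shows that all its
  averages over intervals of \<open>\<eta>\<close> vanish.\<close>

section \<open>Weighted spaces\<close>

lemma Cauchy_Schwarz_integral:
  fixes f g :: "'a \<Rightarrow> real"
  assumes [measurable]: "f \<in> borel_measurable M" "g \<in> borel_measurable M"
    and f2: "integrable M (\<lambda>x. (f x)\<^sup>2)" and g2: "integrable M (\<lambda>x. (g x)\<^sup>2)"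
  shows "integrable M (\<lambda>x. f x * g x)"
    and "(LINT x|M. \<bar>f x * g x\<bar>)\<^sup>2 \<le> (LINT x|M. (f x)\<^sup>2) * (LINT x|M. (g x)\<^sup>2)"
proof -
  have bd: "\<bar>a * b\<bar> \<le> a\<^sup>2 + b\<^sup>2" for a b :: real
    using sum_squares_bound[of "\<bar>a\<bar>" "\<bar>b\<bar>"] abs_ge_zero[of "a * b"]
    unfolding power2_abs abs_mult by linarith
  show int: "integrable M (\<lambda>x. f x * g x)"
    by (rule Bochner_Integration.integrable_bound[OF Bochner_Integration.integrable_add[OF f2 g2]])
      (auto simp: bd)
  define A B C where "A = (LINT x|M. (f x)\<^sup>2)" and "B = (LINT x|M. \<bar>f x * g x\<bar>)"
    and "C = (LINT x|M. (g x)\<^sup>2)"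
  \<comment> \<open>Expanding a nonnegative square gives a quadratic in \<open>t\<close>; that its
    discriminant is nonpositive is the Cauchy-Schwarz inequality.\<close>
  have quad: "0 \<le> t\<^sup>2 * A - 2 * t * B + C" for t
  proof -
    have "0 \<le> (LINT x|M. (t * \<bar>f x\<bar> - \<bar>g x\<bar>)\<^sup>2)" by simp
    also have "\<dots> = (LINT x|M. t\<^sup>2 * (f x)\<^sup>2 - 2 * t * \<bar>f x * g x\<bar> + (g x)\<^sup>2)"
      by (rule Bochner_Integration.integral_cong)
        (simp_all add: power2_diff power_mult_distrib abs_mult)
    also have "\<dots> = t\<^sup>2 * A - 2 * t * B + C"
      using f2 g2 int by (simp add: A_def B_def C_def)
    finally show ?thesis .
  qed
  have nonneg: "A \<ge> 0" "B \<ge> 0" "C \<ge> 0" by (simp_all add: A_def B_def C_def)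
  have "B\<^sup>2 \<le> A * C"
  proof (cases "A = 0")
    case True
    have "B = 0"
    proof (rule ccontr)
      assume "B \<noteq> 0"
      with nonneg have "B > 0" by simp
      \<comment> \<open>With \<open>A = 0\<close> the quadratic is affine in \<open>t\<close> and
        takes the value -1 at this point.\<close>
      with quad[of "(C + 1) / (2 * B)"] True show False by simp
    qed
    with True show ?thesis by simp
  next
    case False
    with nonneg have "A > 0" by simp
    \<comment> \<open>\<open>B / A\<close> is the minimiser of the quadratic.\<close>
    with quad[of "B / A"] show ?thesis
      by (simp add: field_simps power2_eq_square)
  qed
  then show "(LINT x|M. \<bar>f x * g x\<bar>)\<^sup>2 \<le> (LINT x|M. (f x)\<^sup>2) * (LINT x|M. (g x)\<^sup>2)"
    by (simp add: A_def B_def C_def)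
qed

lemma integrable_tensor:
  fixes f :: "'a::euclidean_space \<Rightarrow> real" and g :: "'b::euclidean_space \<Rightarrow> real"
  assumes "integrable lborel f" "integrable lborel g"
  shows "integrable lborel (\<lambda>p. f (fst p) * g (snd p))"
proof -
  have [measurable]: "f \<in> borel_measurable borel" "g \<in> borel_measurable borel"
    using assms by auto
  have "integrable (lborel \<Otimes>\<^sub>M lborel) (\<lambda>p. f (fst p) * g (snd p))"
  proof (rule lborel_pair.Fubini_integrable)
    show "(\<lambda>p. f (fst p) * g (snd p)) \<in> borel_measurable (lborel \<Otimes>\<^sub>M lborel)" by measurable
  qed (use assms in \<open>auto simp: abs_mult\<close>)
  then show ?thesis by (simp add: lborel_prod)
qed

lemma integrable_two_powers:
  fixes a b :: real
  assumes "0 \<le> a" "a < 1" "1 < b"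
  shows "integrable lborel (\<lambda>x::real. if \<bar>x\<bar> \<le> 1 then \<bar>x\<bar> powr - a else \<bar>x\<bar> powr - b)"
proof -
  \<comment> \<open>The two pieces overlap at 1, which is harmless: \<open>g x + g (- x)\<close>
    serves only as a majorant.\<close>
  define g :: "real \<Rightarrow> real" where
    "g x = indicator {0..1} x * x powr - a + indicator {1..} x * x powr - b" for x
  have "(\<lambda>x. x powr - a) absolutely_integrable_on {0..1::real}"
    using integrable_on_powr_from_0[of "- a" 1] assms
    by (subst absolutely_integrable_on_iff_nonneg) auto
  then have 1: "integrable lborel (\<lambda>x::real. indicator {0..1} x * x powr - a)"
    unfolding set_integrable_def by (subst (asm) integrable_completion) auto
  have "(\<lambda>x. x powr - b) absolutely_integrable_on {1::real..}"
    using has_integral_powr_to_inf[of "- b" 1] assms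
    by (subst absolutely_integrable_on_iff_nonneg) (auto simp: integrable_on_def)
  then have 2: "integrable lborel (\<lambda>x::real. indicator {1..} x * x powr - b)"
    unfolding set_integrable_def by (subst (asm) integrable_completion) auto
  have g: "integrable lborel g"
    unfolding g_def by (intro Bochner_Integration.integrable_add 1 2)
  have "integrable lborel (\<lambda>x. g (0 + (- 1) * x))"
    by (rule lborel_integrable_real_affine[OF g]) simp
  then have "integrable lborel (\<lambda>x. g x + g (- x))"
    using g by simp
  then show ?thesis
    by (rule Bochner_Integration.integrable_bound) (auto simp: g_def indicator_def)
qed

lemma integrable_inverse_one_plus_square: "integrable lborel (\<lambda>x::real. 1 / (1 + x\<^sup>2))"
proof (rule Bochner_Integration.integrable_bound)
  show "integrable lborel (\<lambda>x::real. if \<bar>x\<bar> \<le> 1 then \<bar>x\<bar> powr - (1/2) else \<bar>x\<bar> powr - 2)"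
    by (rule integrable_two_powers) auto
  \<comment> \<open>The origin is left out because \<open>0 powr - (1/2) = 0\<close>, so the
    majorant is too small there; a single point is a null set.\<close>
  have *: "norm (1 / (1 + x\<^sup>2)) \<le> norm (if \<bar>x\<bar> \<le> 1 then \<bar>x\<bar> powr - (1/2) else \<bar>x\<bar> powr - 2)"
    if "x \<noteq> 0" for x :: real
  proof (cases "\<bar>x\<bar> \<le> 1")
    case True
    have "1 / (1 + x\<^sup>2) \<le> 1" by (simp add: divide_le_eq add_pos_nonneg)
    also have "1 \<le> \<bar>x\<bar> powr - (1/2)"
      using True that by (simp add: powr_minus powr_le1 one_le_inverse_iff)
    finally show ?thesis using True by simp
  next
    case False
    have "\<bar>x\<bar> powr - 2 = 1 / x\<^sup>2"
      using that by (simp add: powr_minus divide_inverse)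
    then show ?thesis using False by (simp add: frac_le)
  qed
  have "AE x in lborel. x \<noteq> (0::real)"
    by (rule AE_lborel_singleton)
  then show "AE x in lborel. norm (1 / (1 + x\<^sup>2))
      \<le> norm (if \<bar>x\<bar> \<le> 1 then \<bar>x\<bar> powr - (1/2) else \<bar>x\<bar> powr - (2::real))"
    by (rule eventually_mono) (rule *)
qed simp

lemma pair_borel_measurable [measurable]:
  "fst \<in> borel_measurable (borel :: ('a::second_countable_topology \<times> 'b::second_countable_topology) measure)"
  "snd \<in> borel_measurable (borel :: ('a::second_countable_topology \<times> 'b::second_countable_topology) measure)"
  by (simp_all add: borel_prod[symmetric])

section \<open>The comparison function and pairings with the weighted space\<close>

text \<open>An integrable density whose reciprocal grows only like the fourth powers of the
  coordinates. Splitting off \<open>sqrt (hprod p)\<close> in Cauchy-Schwarz therefore costs no more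
  than the weight of \<open>weightL2\<close> with exponents at least 2.\<close>

definition hprod :: "real \<times> real \<Rightarrow> real" where
  "hprod p = 1 / ((1 + (fst p)\<^sup>2) * (1 + (snd p)\<^sup>2))"

lemma hprod_pos: "hprod p > 0"
  by (simp add: hprod_def add_pos_nonneg)

lemma hprod_measurable [measurable]: "hprod \<in> borel_measurable borel"
  unfolding hprod_def[abs_def] by measurable

lemma integrable_hprod: "integrable lborel hprod"
  using integrable_tensor[OF integrable_inverse_one_plus_square integrable_inverse_one_plus_square]
  by (simp add: hprod_def[abs_def])

lemma fourth_power_le_powr:
  fixes x r :: real
  assumes "r \<ge> 2"
  shows "x ^ 4 \<le> 1 + \<bar>x\<bar> powr (2 * r)"
proof (cases "\<bar>x\<bar> \<le> 1")
  case True
  then have "\<bar>x\<bar> ^ 4 \<le> 1" by (rule power_le_one[OF abs_ge_zero])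
  then show ?thesis by (simp add: add_increasing2)
next
  case False
  then have "\<bar>x\<bar> powr 4 \<le> \<bar>x\<bar> powr (2 * r)"
    using assms by (intro powr_mono) auto
  moreover have "\<bar>x\<bar> powr 4 = x ^ 4" using False by simp
  ultimately show ?thesis by simp
qed

definition weight :: "real \<Rightarrow> real \<Rightarrow> real \<times> real \<Rightarrow> real" where
  "weight r1 r2 p = 1 + \<bar>fst p\<bar> powr (2 * r1) + \<bar>snd p\<bar> powr (2 * r2)"

lemma weight_ge_1: "weight r1 r2 p \<ge> 1"
  by (simp add: weight_def)

lemma weight_measurable [measurable]: "weight r1 r2 \<in> borel_measurable borel"
  unfolding weight_def[abs_def] by measurable

text \<open>The arithmetic-geometric mean inequality turns
  \<open>(1 + x\<^sup>2) * (1 + y\<^sup>2)\<close> into a sum of pure fourth powers, and these are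
  controlled because both exponents are at least 2.\<close>

lemma inverse_hprod_le_weight:
  assumes "r1 \<ge> 2" "r2 \<ge> 2"
  shows "1 / hprod p \<le> 4 * weight r1 r2 p"
proof -
  obtain x y where p: "p = (x, y)" by (cases p)
  have "x\<^sup>2 \<le> (1 + x ^ 4) / 2"
    using sum_squares_bound[of 1 "x\<^sup>2"] by simp
  moreover have "y\<^sup>2 \<le> (1 + y ^ 4) / 2"
    using sum_squares_bound[of 1 "y\<^sup>2"] by simp
  moreover have "x\<^sup>2 * y\<^sup>2 \<le> (x ^ 4 + y ^ 4) / 2"
    using sum_squares_bound[of "x\<^sup>2" "y\<^sup>2"] by simp
  ultimately have "(1 + x\<^sup>2) * (1 + y\<^sup>2) \<le> 2 + x ^ 4 + y ^ 4"
    by (simp add: algebra_simps)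
  also have "\<dots> \<le> 4 * weight r1 r2 p"
  proof -
    have *: "2 + A + B \<le> 4 * (1 + A' + B')" if "A \<le> 1 + A'" "B \<le> 1 + B'" "0 \<le> A'" "0 \<le> B'"
      for A B A' B' :: real
      using that by (simp add: algebra_simps)
    show ?thesis
      unfolding weight_def p fst_conv snd_conv
      by (rule *) (simp_all add: assms fourth_power_le_powr)
  qed
  finally show ?thesis by (simp add: hprod_def p)
qed

lemma weightL2_iff: "f \<in> weightL2 r1 r2 \<longleftrightarrow>
    f \<in> borel_measurable borel \<and> integrable lborel (\<lambda>p. weight r1 r2 p * (f p)\<^sup>2)"
  by (simp add: weightL2_def weight_def)

lemma weightL2_dominated:
  assumes "f \<in> weightL2 r1 r2" and [measurable]: "g \<in> borel_measurable borel"
    and "\<And>p. \<bar>g p\<bar> \<le> C * weight r1 r2 p"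
  shows "integrable lborel (\<lambda>p. g p * (f p)\<^sup>2)"
    and "(LINT p|lborel. g p * (f p)\<^sup>2) \<le> C * weightL2_norm2 r1 r2 f"
proof -
  have [measurable]: "f \<in> borel_measurable borel"
    and int: "integrable lborel (\<lambda>p. C * (weight r1 r2 p * (f p)\<^sup>2))"
    using assms(1) by (auto simp: weightL2_iff)
  have bd: "\<bar>g p * (f p)\<^sup>2\<bar> \<le> C * (weight r1 r2 p * (f p)\<^sup>2)" for p
    using mult_right_mono[OF assms(3)[of p], of "(f p)\<^sup>2"] by (simp add: abs_mult mult.assoc)
  show 1: "integrable lborel (\<lambda>p. g p * (f p)\<^sup>2)"
    by (rule Bochner_Integration.integrable_bound[OF int])
      (auto intro: order_trans[OF bd abs_ge_self])
  have "(LINT p|lborel. g p * (f p)\<^sup>2) \<le> (LINT p|lborel. C * (weight r1 r2 p * (f p)\<^sup>2))"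
    by (rule integral_mono[OF 1 int]) (use bd abs_le_D1 in blast)
  then show "(LINT p|lborel. g p * (f p)\<^sup>2) \<le> C * weightL2_norm2 r1 r2 f"
    by (simp add: weightL2_norm2_def weight_def)
qed

text \<open>Cauchy-Schwarz for the factors \<open>g * sqrt hprod\<close> and
  \<open>f / sqrt hprod\<close>. With \<open>g = 1\<close> it shows that \<open>f\<close> is
  integrable, so that its Fourier transform is meaningful. With a small cutoff as \<open>g\<close>
  it gives smallness depending on \<open>f\<close> only through its norm, hence uniform in time
  along the solution.\<close>

lemma weightL2_pairing:
  assumes f: "f \<in> weightL2 r1 r2" and r: "r1 \<ge> 2" "r2 \<ge> 2"
    and [measurable]: "g \<in> borel_measurable borel" and g: "\<And>p. \<bar>g p\<bar> \<le> 1"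
  shows "integrable lborel (\<lambda>p. g p * f p)"
    and "(LINT p|lborel. \<bar>g p * f p\<bar>)\<^sup>2
      \<le> 4 * weightL2_norm2 r1 r2 f * (LINT p|lborel. (g p)\<^sup>2 * hprod p)"
proof -
  have [measurable]: "f \<in> borel_measurable borel"
    using f by (simp add: weightL2_iff)
  define F G where "F p = g p * sqrt (hprod p)" and "G p = sqrt (1 / hprod p) * f p" for p
  have [measurable]: "F \<in> borel_measurable borel" "G \<in> borel_measurable borel"
    unfolding F_def[abs_def] G_def[abs_def] by measurable
  have FG: "F p * G p = g p * f p" for p
    using hprod_pos[of p] by (simp add: F_def G_def real_sqrt_divide)
  have F2: "(F p)\<^sup>2 = (g p)\<^sup>2 * hprod p" and G2: "(G p)\<^sup>2 = 1 / hprod p * (f p)\<^sup>2" for p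
    using hprod_pos[of p] by (simp_all add: F_def G_def power_mult_distrib power_divide real_sqrt_divide)
  have bd: "\<bar>1 / hprod p\<bar> \<le> 4 * weight r1 r2 p" for p
    using inverse_hprod_le_weight[OF r, of p] hprod_pos[of p] by simp
  note G = weightL2_dominated[OF f _ bd]
  have iG: "integrable lborel (\<lambda>p. (G p)\<^sup>2)"
    unfolding G2 by (rule G(1)) measurable
  have "(g p)\<^sup>2 \<le> 1" for p
    using g[of p] by (simp add: abs_square_le_1)
  then have iF: "integrable lborel (\<lambda>p. (F p)\<^sup>2)"
    unfolding F2
    by (intro Bochner_Integration.integrable_bound[OF integrable_hprod])
      (auto simp: abs_mult mult_left_le_one_le)
  have "integrable lborel (\<lambda>p. F p * G p)"
    by (rule Cauchy_Schwarz_integral[OF _ _ iF iG]) simp_all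
  then show "integrable lborel (\<lambda>p. g p * f p)" by (simp add: FG)
  have "(LINT p|lborel. \<bar>g p * f p\<bar>)\<^sup>2 \<le> (LINT p|lborel. (F p)\<^sup>2) * (LINT p|lborel. (G p)\<^sup>2)"
    using Cauchy_Schwarz_integral(2)[OF _ _ iF iG] by (simp add: FG)
  also have "\<dots> \<le> (LINT p|lborel. (F p)\<^sup>2) * (4 * weightL2_norm2 r1 r2 f)"
  proof (rule mult_left_mono)
    show "(LINT p|lborel. (G p)\<^sup>2) \<le> 4 * weightL2_norm2 r1 r2 f"
      unfolding G2 by (rule G(2)) measurable
  qed simp
  finally show "(LINT p|lborel. \<bar>g p * f p\<bar>)\<^sup>2
      \<le> 4 * weightL2_norm2 r1 r2 f * (LINT p|lborel. (g p)\<^sup>2 * hprod p)"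
    by (simp add: F2 mult.commute)
qed

lemma integral_tensor:
  fixes f g :: "real \<Rightarrow> real"
  assumes "integrable lborel f" "integrable lborel g"
  shows "(LINT p|lborel. f (fst p) * g (snd p)) = (LINT x|lborel. f x) * (LINT y|lborel. g y)"
proof -
  have "integrable (lborel \<Otimes>\<^sub>M lborel) (\<lambda>(x, y). f x * g y)"
    using integrable_tensor[OF assms] by (simp add: lborel_prod case_prod_unfold)
  from lborel_pair.integral_fst[OF this] show ?thesis
    by (simp add: lborel_prod case_prod_unfold)
qed

section \<open>The weighted norm along the solution\<close>

lemma weightL2_norm2_triangle:
  assumes f: "f \<in> weightL2 r1 r2" and g: "g \<in> weightL2 r1 r2"
  shows "weightL2_norm2 r1 r2 f
    \<le> 2 * weightL2_norm2 r1 r2 (\<lambda>p. f p - g p) + 2 * weightL2_norm2 r1 r2 g"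
proof -
  have [measurable]: "f \<in> borel_measurable borel" "g \<in> borel_measurable borel"
    and f: "integrable lborel (\<lambda>p. weight r1 r2 p * (f p)\<^sup>2)"
    and g: "integrable lborel (\<lambda>p. weight r1 r2 p * (g p)\<^sup>2)"
    using f g by (auto simp: weightL2_iff)
  \<comment> \<open>The differences of the two sides are the squares of \<open>x + y\<close> and of
    \<open>x - 2 * y\<close>.\<close>
  have sq: "(x - y)\<^sup>2 \<le> 2 * x\<^sup>2 + 2 * y\<^sup>2" "x\<^sup>2 \<le> 2 * (x - y)\<^sup>2 + 2 * y\<^sup>2" for x y :: real
    using zero_le_power2[of "x + y"] zero_le_power2[of "x - 2 * y"]
    by (simp_all add: power2_eq_square algebra_simps)
  have d: "integrable lborel (\<lambda>p. weight r1 r2 p * (f p - g p)\<^sup>2)"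
  proof (rule Bochner_Integration.integrable_bound)
    show "integrable lborel (\<lambda>p. 2 * (weight r1 r2 p * (f p)\<^sup>2) + 2 * (weight r1 r2 p * (g p)\<^sup>2))"
      using f g by simp
    have "\<bar>weight r1 r2 p * (f p - g p)\<^sup>2\<bar>
        \<le> \<bar>weight r1 r2 p * (2 * (f p)\<^sup>2 + 2 * (g p)\<^sup>2)\<bar>" for p
      unfolding abs_mult using sq(1)[of "f p" "g p"] by (intro mult_left_mono) auto
    then show "AE p in lborel. norm (weight r1 r2 p * (f p - g p)\<^sup>2)
      \<le> norm (2 * (weight r1 r2 p * (f p)\<^sup>2) + 2 * (weight r1 r2 p * (g p)\<^sup>2))"
      by (simp add: algebra_simps)
  qed simp
  have "(LINT p|lborel. weight r1 r2 p * (f p)\<^sup>2)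
    \<le> (LINT p|lborel. 2 * (weight r1 r2 p * (f p - g p)\<^sup>2) + 2 * (weight r1 r2 p * (g p)\<^sup>2))"
  proof (rule integral_mono)
    fix p
    have "weight r1 r2 p * (f p)\<^sup>2 \<le> weight r1 r2 p * (2 * (f p - g p)\<^sup>2 + 2 * (g p)\<^sup>2)"
      using weight_ge_1[of r1 r2 p] by (intro mult_left_mono sq) simp
    then show "weight r1 r2 p * (f p)\<^sup>2
      \<le> 2 * (weight r1 r2 p * (f p - g p)\<^sup>2) + 2 * (weight r1 r2 p * (g p)\<^sup>2)"
      by (simp add: algebra_simps)
  qed (use d f g in simp_all)
  also have "\<dots> = 2 * (LINT p|lborel. weight r1 r2 p * (f p - g p)\<^sup>2)
      + 2 * (LINT p|lborel. weight r1 r2 p * (g p)\<^sup>2)"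
    using d g by simp
  finally show ?thesis
    by (simp add: weightL2_norm2_def weight_def)
qed

lemma weightL2_norm2_le_Znorm: "weightL2_norm2 r1 r2 f \<le> (Znorm a s r1 r2 f)\<^sup>2"
proof -
  have "0 \<le> Hsob_norm2 ((1 + a) * s) (2 * s) f"
    unfolding Hsob_norm2_def
    by (intro add_nonneg_nonneg mult_nonneg_nonneg Bochner_Integration.integral_nonneg) auto
  moreover have "0 \<le> weightL2_norm2 r1 r2 f"
    unfolding weightL2_norm2_def
    by (intro Bochner_Integration.integral_nonneg mult_nonneg_nonneg) auto
  ultimately show ?thesis by (simp add: Znorm_def)
qed

text \<open>Continuity in time bounds the norm near each time, and compactness of
  \<open>{0..T}\<close> makes the bound global. The errors in the evolution have to be uniform in
  time before they can be integrated.\<close>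

lemma in_CZ_weight_bounded:
  assumes "in_CZ a s r1 r2 T u"
  obtains M where "\<And>t. t \<in> {0..T} \<Longrightarrow> weightL2_norm2 r1 r2 (u t) \<le> M"
proof -
  have mem: "u t \<in> weightL2 r1 r2" if "t \<in> {0..T}" for t
    using assms that by (auto simp: in_CZ_def Zspace_def)
  have "\<exists>d>0. \<forall>t\<in>{0..T}. dist t t0 < d \<longrightarrow>
      weightL2_norm2 r1 r2 (u t) \<le> 2 + 2 * weightL2_norm2 r1 r2 (u t0)"
    if t0: "t0 \<in> {0..T}" for t0
  proof -
    have "((\<lambda>t. Znorm a s r1 r2 (\<lambda>p. u t p - u t0 p)) \<longlongrightarrow> 0) (at t0 within {0..T})"
      using assms t0 by (auto simp: in_CZ_def)
    from tendstoD[OF this zero_less_one] obtain d where d: "d > 0"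
      "\<And>t. t \<in> {0..T} \<Longrightarrow> t \<noteq> t0 \<Longrightarrow> dist t t0 < d \<Longrightarrow>
        \<bar>Znorm a s r1 r2 (\<lambda>p. u t p - u t0 p)\<bar> < 1"
      by (auto simp: eventually_at)
    show ?thesis
    proof (intro exI[of _ d] conjI ballI impI)
      fix t assume t: "t \<in> {0..T}" "dist t t0 < d"
      show "weightL2_norm2 r1 r2 (u t) \<le> 2 + 2 * weightL2_norm2 r1 r2 (u t0)"
      \<comment> \<open>The filter \<open>at t0 within {0..T}\<close> says nothing about
        \<open>t0\<close> itself.\<close>
      proof (cases "t = t0")
        case True
        have "0 \<le> weightL2_norm2 r1 r2 (u t0)"
          unfolding weightL2_norm2_def
          by (intro Bochner_Integration.integral_nonneg mult_nonneg_nonneg) auto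
        with True show ?thesis by simp
      next
        case False
        have "(Znorm a s r1 r2 (\<lambda>p. u t p - u t0 p))\<^sup>2 \<le> 1"
          using d(2)[OF t(1) False t(2)] by (simp add: abs_square_le_1)
        with weightL2_norm2_triangle[OF mem[OF t(1)] mem[OF t0]]
          weightL2_norm2_le_Znorm[of r1 r2 "\<lambda>p. u t p - u t0 p" a s]
        show ?thesis by linarith
      qed
    qed (fact d)
  qed
  then obtain d where d: "\<And>t0. t0 \<in> {0..T} \<Longrightarrow> d t0 > 0"
    "\<And>t0 t. t0 \<in> {0..T} \<Longrightarrow> t \<in> {0..T} \<Longrightarrow> dist t t0 < d t0 \<Longrightarrow>
      weightL2_norm2 r1 r2 (u t) \<le> 2 + 2 * weightL2_norm2 r1 r2 (u t0)"
    by metis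
  obtain C where C: "C \<subseteq> {0..T}" "finite C" "{0..T} \<subseteq> (\<Union>c\<in>C. ball c (d c))"
    by (rule compactE_image[of "{0..T}" "{0..T}" "\<lambda>c. ball c (d c)"]) (use d(1) in auto)
  \<comment> \<open>The absolute values keep all summands nonnegative, so that each one is at most
    the sum.\<close>
  define M where "M = (\<Sum>c\<in>C. 2 + 2 * \<bar>weightL2_norm2 r1 r2 (u c)\<bar>)"
  have "weightL2_norm2 r1 r2 (u t) \<le> M" if t: "t \<in> {0..T}" for t
  proof -
    from t C(3) obtain c where c: "c \<in> C" "dist t c < d c"
      by (auto simp: dist_commute)
    have "weightL2_norm2 r1 r2 (u t) \<le> 2 + 2 * \<bar>weightL2_norm2 r1 r2 (u c)\<bar>"
      using d(2)[of c t] c t C(1) by auto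
    also have "\<dots> \<le> M"
      unfolding M_def by (rule member_le_sum) (use c C in auto)
    finally show ?thesis .
  qed
  with that show ?thesis by blast
qed

section \<open>Odd third differences and oscillatory kernels\<close>

text \<open>The central third difference at 0: it annihilates even functions and polynomials of
  degree at most 2, and equals \<open>2 * f'''(0) * l ^ 3\<close> to leading order for smooth
  \<open>f\<close>. A term homogeneous of degree \<open>2 + a\<close> with \<open>a < 1\<close> is
  thus larger than anything smooth.\<close>

definition stencil :: "(real \<Rightarrow> complex) \<Rightarrow> real \<Rightarrow> complex" where
  "stencil f l = f (2 * l) - 2 * f l + 2 * f (- l) - f (- (2 * l))"

lemma integral_stencil:
  assumes "\<And>\<xi>. integrable M (g \<xi>)"
  shows "stencil (\<lambda>\<xi>. LINT p|M. g \<xi> p) l = (LINT p|M. stencil (\<lambda>\<xi>. g \<xi> p) l)"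
  using assms by (simp add: stencil_def)

lemma stencil_mult_right: "stencil (\<lambda>\<xi>. f \<xi> * c) l = stencil f l * c"
  by (simp add: stencil_def algebra_simps)

text \<open>The Fourier symbol of \<open>stencil\<close>, that is, 4 sin \<theta> - 2 sin 2\<theta>;
  the factored form displays the zero of order three at 0.\<close>

definition symb :: "real \<Rightarrow> real" where
  "symb \<theta> = 4 * sin \<theta> * (1 - cos \<theta>)"

definition symb' :: "real \<Rightarrow> real" where
  "symb' \<theta> = 4 * (cos \<theta> * (1 - cos \<theta>) + (sin \<theta>)\<^sup>2)"

lemma symb_has_derivative: "(symb has_real_derivative symb' \<theta>) (at \<theta>)"
  unfolding symb_def[abs_def] symb'_def
  by (auto intro!: derivative_eq_intros simp: power2_eq_square algebra_simps)

lemma stencil_cis: "stencil (\<lambda>\<xi>. cis (- (\<xi> * x))) l = \<i> * complex_of_real (symb (l * x))"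
  using sin_double[of "l * x"]
  by (simp add: stencil_def symb_def complex_eq_iff algebra_simps)

text \<open>The odd factor \<xi> leaves cosines instead of sines. Their difference vanishes to
  second order, so the result is of order \<open>l ^ 3 * x\<^sup>2\<close> and needs only two
  moments in x, which the nonlinear term has.\<close>

lemma stencil_mult_cis:
  "stencil (\<lambda>\<xi>. complex_of_real \<xi> * cis (- (\<xi> * x))) l
    = complex_of_real (4 * l * (cos (2 * (l * x)) - cos (l * x)))"
  by (simp add: stencil_def complex_eq_iff algebra_simps)

section \<open>Elementary bounds for the symbols\<close>

lemma abs_sin_le_min: "\<bar>\<theta>\<bar> \<le> z \<Longrightarrow> \<bar>sin \<theta>\<bar> \<le> min 1 (z::real)"
  using abs_sin_x_le_abs_x[of \<theta>] by auto

lemma one_minus_cos_le: "\<bar>\<theta>\<bar> \<le> z \<Longrightarrow> \<bar>1 - cos \<theta>\<bar> \<le> 2 * (min 1 (z::real))\<^sup>2"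
proof -
  assume z: "\<bar>\<theta>\<bar> \<le> z"
  have "1 - cos \<theta> = 2 * (sin (\<theta> / 2))\<^sup>2"
    using cos_double_sin[of "\<theta> / 2"] by simp
  moreover have "\<bar>sin (\<theta> / 2)\<bar> \<le> min 1 z"
    using z by (intro abs_sin_le_min) auto
  then have "\<bar>sin (\<theta> / 2)\<bar>\<^sup>2 \<le> (min 1 z)\<^sup>2" by (intro power_mono) auto
  ultimately show ?thesis by simp
qed

text \<open>The sine contributes one power of \<open>min 1 z\<close> and the factor with the cosine
  two. The minimum joins the cubic zero at 0 to boundedness at infinity; \<open>symb'\<close> keeps
  one power less.\<close>

lemma abs_symb_le:
  assumes "\<bar>\<theta>\<bar> \<le> z"
  shows "\<bar>symb \<theta>\<bar> \<le> 8 * (min 1 z) ^ 3"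
proof -
  have "\<bar>sin \<theta>\<bar> * \<bar>1 - cos \<theta>\<bar> \<le> min 1 z * (2 * (min 1 z)\<^sup>2)"
    using assms by (intro mult_mono abs_sin_le_min one_minus_cos_le) auto
  moreover have "\<bar>symb \<theta>\<bar> = 4 * (\<bar>sin \<theta>\<bar> * \<bar>1 - cos \<theta>\<bar>)"
    by (simp add: symb_def abs_mult)
  ultimately show ?thesis
    by (simp add: power2_eq_square power3_eq_cube)
qed

lemma abs_symb'_le:
  assumes "\<bar>\<theta>\<bar> \<le> z"
  shows "\<bar>symb' \<theta>\<bar> \<le> 12 * (min 1 z)\<^sup>2"
proof -
  have "\<bar>cos \<theta>\<bar> * \<bar>1 - cos \<theta>\<bar> \<le> 1 * (2 * (min 1 z)\<^sup>2)"
    using assms by (intro mult_mono one_minus_cos_le) auto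
  moreover have "\<bar>sin \<theta>\<bar>\<^sup>2 \<le> (min 1 z)\<^sup>2"
    using abs_sin_le_min[OF assms] by (intro power_mono) auto
  ultimately have "\<bar>cos \<theta>\<bar> * \<bar>1 - cos \<theta>\<bar> + \<bar>sin \<theta>\<bar>\<^sup>2 \<le> 3 * (min 1 z)\<^sup>2"
    by simp
  moreover have "\<bar>symb' \<theta>\<bar> \<le> 4 * (\<bar>cos \<theta>\<bar> * \<bar>1 - cos \<theta>\<bar> + \<bar>sin \<theta>\<bar>\<^sup>2)"
    unfolding symb'_def abs_mult[symmetric] power2_abs
    using abs_triangle_ineq[of "cos \<theta> * (1 - cos \<theta>)" "(sin \<theta>)\<^sup>2"] by (simp add: abs_mult)
  ultimately show ?thesis by simp
qed

lemma abs_cos_double_minus_cos_le: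
  assumes "\<bar>\<theta>\<bar> \<le> z"
  shows "\<bar>cos (2 * \<theta>) - cos \<theta>\<bar> \<le> 10 * (z::real)\<^sup>2"
proof -
  have z: "z \<ge> 0" using assms by linarith
  have m: "(min 1 w)\<^sup>2 \<le> w\<^sup>2" if "w \<ge> 0" for w :: real
    using that by (intro power_mono) auto
  \<comment> \<open>The constant 10 is made of 8 from the doubled angle and 2 from the single
    one.\<close>
  have "\<bar>1 - cos (2 * \<theta>)\<bar> \<le> 2 * (2 * z)\<^sup>2"
  proof -
    have "\<bar>2 * \<theta>\<bar> \<le> 2 * z" using assms by linarith
    from one_minus_cos_le[OF this] m[of "2 * z"] z show ?thesis by linarith
  qed
  moreover have "\<bar>1 - cos \<theta>\<bar> \<le> 2 * z\<^sup>2"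
    using one_minus_cos_le[OF assms] m[OF z] by linarith
  moreover have "\<bar>cos (2 * \<theta>) - cos \<theta>\<bar> \<le> \<bar>1 - cos (2 * \<theta>)\<bar> + \<bar>1 - cos \<theta>\<bar>"
    by linarith
  ultimately show ?thesis unfolding power_mult_distrib by simp
qed

lemma norm_cis_minus_one_le: "\<bar>\<theta>\<bar> \<le> 2 * z \<Longrightarrow> cmod (cis \<theta> - 1) \<le> 2 * min 1 z"
proof -
  assume z: "\<bar>\<theta>\<bar> \<le> 2 * z"
  have "cmod (cis \<theta> - 1) = 2 * \<bar>sin (\<theta> / 2)\<bar>"
    using dist_exp_i_1[of \<theta>] by (simp add: cis_conv_exp)
  also have "\<bar>sin (\<theta> / 2)\<bar> \<le> min 1 z"
    using z by (intro abs_sin_le_min) auto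
  finally show ?thesis by simp
qed

section \<open>Decay in y gained from averaging over \<eta>\<close>

text \<open>One integration by parts gives the bound with factor \<open>\<bar>y\<bar>\<close>, where
  \<open>2 * A\<close> comes from the end points; adding the trivial bound covers small
  \<open>y\<close>.\<close>

lemma oscillatory_integral_bound:
  fixes p p' :: "real \<Rightarrow> complex"
  assumes ab: "\<alpha> \<le> \<beta>"
    and deriv: "\<And>\<eta>. \<eta> \<in> {\<alpha>..\<beta>} \<Longrightarrow> (p has_vector_derivative p' \<eta>) (at \<eta> within {\<alpha>..\<beta>})"
    and cont: "continuous_on {\<alpha>..\<beta>} p'"
    and A: "\<And>\<eta>. \<eta> \<in> {\<alpha>..\<beta>} \<Longrightarrow> cmod (p \<eta>) \<le> A"
    and A': "\<And>\<eta>. \<eta> \<in> {\<alpha>..\<beta>} \<Longrightarrow> cmod (p' \<eta>) \<le> A'"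
  shows "(1 + \<bar>y\<bar>) * cmod (integral {\<alpha>..\<beta>} (\<lambda>\<eta>. cis (- (y * \<eta>)) * p \<eta>))
    \<le> A * (\<beta> - \<alpha>) + 2 * A + A' * (\<beta> - \<alpha>)"
proof -
  define I J where "I = integral {\<alpha>..\<beta>} (\<lambda>\<eta>. cis (- (y * \<eta>)) * p \<eta>)"
    and "J = integral {\<alpha>..\<beta>} (\<lambda>\<eta>. cis (- (y * \<eta>)) * p' \<eta>)"
  define F where "F \<eta> = cis (- (y * \<eta>)) * p \<eta>" for \<eta>
  have contp: "continuous_on {\<alpha>..\<beta>} p"
    using deriv by (rule continuous_on_vector_derivative)
  have "((\<lambda>\<eta>. cis (- (y * \<eta>))) has_vector_derivative - (\<i> * y) * cis (- (y * \<eta>))) (at \<eta> within {\<alpha>..\<beta>})"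
    for \<eta>
    using exp_scaleR_has_vector_derivative_right[of "- (\<i> * complex_of_real y)" \<eta> "{\<alpha>..\<beta>}"]
    by (simp add: cis_conv_exp scaleR_conv_of_real mult_ac)
  then have "(F has_vector_derivative
      (cis (- (y * \<eta>)) * p' \<eta> + (- (\<i> * y) * cis (- (y * \<eta>))) * p \<eta>)) (at \<eta> within {\<alpha>..\<beta>})"
    if "\<eta> \<in> {\<alpha>..\<beta>}" for \<eta>
    unfolding F_def[abs_def] by (rule has_vector_derivative_mult[OF _ deriv[OF that]])
  from fundamental_theorem_of_calculus[OF ab this]
  have "((\<lambda>\<eta>. cis (- (y * \<eta>)) * p' \<eta> + (- (\<i> * y) * cis (- (y * \<eta>))) * p \<eta>)
      has_integral F \<beta> - F \<alpha>) {\<alpha>..\<beta>}" by simp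
  moreover have int: "(\<lambda>\<eta>. cis (- (y * \<eta>)) * p \<eta>) integrable_on {\<alpha>..\<beta>}"
      "(\<lambda>\<eta>. cis (- (y * \<eta>)) * p' \<eta>) integrable_on {\<alpha>..\<beta>}"
    by (intro integrable_continuous_interval continuous_intros contp cont)+
  then have "((\<lambda>\<eta>. cis (- (y * \<eta>)) * p' \<eta> + (- (\<i> * y)) * (cis (- (y * \<eta>)) * p \<eta>))
      has_integral J + (- (\<i> * y)) * I) {\<alpha>..\<beta>}"
    unfolding I_def J_def
    by (intro has_integral_add has_integral_mult_right integrable_integral)
  ultimately have "F \<beta> - F \<alpha> = J - \<i> * y * I"
    by (simp add: mult.assoc has_integral_unique)
  then have "\<i> * y * I = J - (F \<beta> - F \<alpha>)" by (simp add: algebra_simps)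
  then have "\<bar>y\<bar> * cmod I = cmod (J - (F \<beta> - F \<alpha>))"
    by (metis norm_mult norm_ii mult_1 norm_of_real)
  also have "\<dots> \<le> cmod J + (cmod (F \<beta>) + cmod (F \<alpha>))"
    by (meson add_left_mono norm_triangle_ineq4 order_trans)
  also have "cmod J \<le> A' * (\<beta> - \<alpha>)"
    unfolding J_def
    by (intro integral_bound ab continuous_intros cont) (simp add: norm_mult A')
  also have "cmod (F \<beta>) + cmod (F \<alpha>) \<le> 2 * A"
    using A[of \<alpha>] A[of \<beta>] ab by (simp add: F_def norm_mult)
  finally have 1: "\<bar>y\<bar> * cmod I \<le> A' * (\<beta> - \<alpha>) + 2 * A" by simp
  have "cmod I \<le> A * (\<beta> - \<alpha>)"
    unfolding I_def
    by (intro integral_bound ab continuous_intros contp) (simp add: norm_mult A)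
  with 1 show ?thesis by (simp add: algebra_simps I_def)
qed

text \<open>The factor \<open>1 / (1 + \<bar>y\<bar>)\<close>, square integrable in y, is the
  purpose of averaging in \<eta>: it allows all of the weight on \<open>f\<close> to be spent on x.
  Here \<open>S\<close> bounds the shift \<open>\<eta>\<^sup>2 * t\<close> and \<open>B\<close> its
  derivative in \<eta>.\<close>

lemma kernel_bound:
  fixes \<alpha> \<beta> t l x y S :: real
  assumes ab: "\<alpha> \<le> \<beta>" and l: "0 < l" "l \<le> 1" and S: "S \<ge> 1"
    and B: "\<And>\<eta>. \<eta> \<in> {\<alpha>..\<beta>} \<Longrightarrow> \<eta>\<^sup>2 * \<bar>t\<bar> \<le> S" "\<And>\<eta>. \<eta> \<in> {\<alpha>..\<beta>} \<Longrightarrow> 2 * \<bar>\<eta>\<bar> * \<bar>t\<bar> \<le> B"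
  shows "cmod (integral {\<alpha>..\<beta>} (\<lambda>\<eta>. cis (- (y * \<eta>)) * complex_of_real (symb (l * (x + \<eta>\<^sup>2 * t)))))
    \<le> (8 * (\<beta> - \<alpha>) + 16 + 12 * B * (\<beta> - \<alpha>)) * (min 1 (l * (\<bar>x\<bar> + S))) ^ 3 / (1 + \<bar>y\<bar>)"
proof -
  define m where "m = min 1 (l * (\<bar>x\<bar> + S))"
  define p p' where "p \<eta> = symb (l * (x + \<eta>\<^sup>2 * t))"
    and "p' \<eta> = symb' (l * (x + \<eta>\<^sup>2 * t)) * (l * (2 * \<eta> * t))" for \<eta>
  have arg: "\<bar>l * (x + \<eta>\<^sup>2 * t)\<bar> \<le> l * (\<bar>x\<bar> + S)" if "\<eta> \<in> {\<alpha>..\<beta>}" for \<eta>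
  proof -
    have "\<bar>x + \<eta>\<^sup>2 * t\<bar> \<le> \<bar>x\<bar> + \<bar>\<eta>\<^sup>2 * t\<bar>" by (rule abs_triangle_ineq)
    also have "\<dots> \<le> \<bar>x\<bar> + S" using B(1)[OF that] by (simp add: abs_mult)
    finally show ?thesis using l by (simp add: abs_mult)
  qed
  \<comment> \<open>This uses \<open>S \<ge> 1\<close>. The factor \<open>l\<close> produced by the
    chain rule then replaces the power of \<open>m\<close> that \<open>symb'\<close> lacks.\<close>
  have "l * 1 \<le> l * (\<bar>x\<bar> + S)" using l S by (intro mult_left_mono) auto
  then have lm: "l \<le> m" using l by (simp add: m_def)
  have dp: "(p has_real_derivative p' \<eta>) (at \<eta> within {\<alpha>..\<beta>})" for \<eta>
    unfolding p_def[abs_def] p'_def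
    by (rule DERIV_chain2[OF symb_has_derivative]) (auto intro!: derivative_eq_intros)
  have "(1 + \<bar>y\<bar>) * cmod (integral {\<alpha>..\<beta>} (\<lambda>\<eta>. cis (- (y * \<eta>)) * complex_of_real (p \<eta>)))
    \<le> (8 * m ^ 3) * (\<beta> - \<alpha>) + 2 * (8 * m ^ 3) + (12 * B * m ^ 3) * (\<beta> - \<alpha>)"
  proof (rule oscillatory_integral_bound[where p' = "\<lambda>\<eta>. complex_of_real (p' \<eta>)"])
    show "((\<lambda>\<eta>. complex_of_real (p \<eta>)) has_vector_derivative complex_of_real (p' \<eta>))
        (at \<eta> within {\<alpha>..\<beta>})" for \<eta>
      using dp[of \<eta>]
      by (simp add: has_vector_derivative_of_real has_real_derivative_iff_has_vector_derivative)
    show "continuous_on {\<alpha>..\<beta>} (\<lambda>\<eta>. complex_of_real (p' \<eta>))"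
      unfolding p'_def symb'_def by (intro continuous_intros)
  next
    fix \<eta> assume \<eta>: "\<eta> \<in> {\<alpha>..\<beta>}"
    show "cmod (complex_of_real (p \<eta>)) \<le> 8 * m ^ 3"
      using abs_symb_le[OF arg[OF \<eta>]] by (simp add: p_def m_def)
    have "\<bar>p' \<eta>\<bar> = \<bar>symb' (l * (x + \<eta>\<^sup>2 * t))\<bar> * (l * (2 * \<bar>\<eta>\<bar> * \<bar>t\<bar>))"
      using l by (simp add: p'_def abs_mult)
    also have "\<dots> \<le> 12 * m\<^sup>2 * (m * B)"
      using abs_symb'_le[OF arg[OF \<eta>]] B(2)[OF \<eta>] lm l
      by (intro mult_mono) (auto simp: m_def)
    finally show "cmod (complex_of_real (p' \<eta>)) \<le> 12 * B * m ^ 3"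
      by (simp add: power2_eq_square power3_eq_cube mult_ac)
  qed (fact ab)
  then show ?thesis
    unfolding p_def m_def[symmetric] by (subst pos_le_divide_eq) (simp_all add: algebra_simps)
qed

section \<open>The pairing at the critical exponent\<close>

text \<open>The even extension of \<open>z powr - (5 + 2 * a) * (min 1 z) powr (5 + a)\<close>, the
  profile left by Cauchy-Schwarz after rescaling x by \<open>l\<close>. It is integrable at 0
  because \<open>a < 1\<close>.\<close>

definition kern :: "real \<Rightarrow> real \<Rightarrow> real" where
  "kern a z = (if \<bar>z\<bar> \<le> 1 then \<bar>z\<bar> powr - a else \<bar>z\<bar> powr - (5 + 2 * a))"

lemma kern_measurable [measurable]: "kern a \<in> borel_measurable borel"
  unfolding kern_def[abs_def] by measurable

lemma kern_nonneg: "kern a z \<ge> 0" by (simp add: kern_def)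

lemma integrable_kern: "0 < a \<Longrightarrow> a < 1 \<Longrightarrow> integrable lborel (kern a)"
  unfolding kern_def[abs_def] by (rule integrable_two_powers) auto

lemma kern_eq:
  assumes "0 < z" "0 < a"
  shows "z powr - (5 + 2 * a) * (min 1 z) powr (5 + a) = kern a z"
proof (cases "z \<le> 1")
  case True
  have "z powr - (5 + 2 * a) * z powr (5 + a) = z powr (- (5 + 2 * a) + (5 + a))"
    by (rule powr_add[symmetric])
  then show ?thesis using True assms by (simp add: kern_def min_def)
qed (use assms in \<open>simp add: kern_def\<close>)

text \<open>Cauchy-Schwarz is applied with the weight \<open>X powr (5 + 2 a) * m powr (1 - a)\<close>, where
  \<open>X = \<bar>x\<bar> + S\<close> and \<open>m = min 1 (l X)\<close>: the extra factor \<open>m powr (1 - a)\<close> tends to \<open>0\<close>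
  pointwise with \<open>l\<close> and turns the critical bound \<open>O(l powr (2 + a))\<close> into \<open>o(l powr (2 + a))\<close>.\<close>

lemma critical_pairing_tendsto_0:
  fixes a S r2 :: real and l :: "nat \<Rightarrow> real"
  assumes a: "0 < a" "a < 1" and S: "S \<ge> 1"
    and f: "f \<in> weightL2 (5 / 2 + a) r2"
    and l: "\<And>n. 0 < l n" "l \<longlonglongrightarrow> 0"
  shows "(\<lambda>n. (LINT p|lborel. \<bar>f p\<bar> * (min 1 (l n * (\<bar>fst p\<bar> + S)) ^ 3 / (1 + \<bar>snd p\<bar>)))
    / l n powr (2 + a)) \<longlonglongrightarrow> 0"
proof -
  have [measurable]: "f \<in> borel_measurable borel" using f by (simp add: weightL2_iff)
  define X where "X p = \<bar>fst p\<bar> + S" for p :: "real \<times> real"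
  define m where "m n p = min 1 (l n * X p)" for n p
  have [measurable]: "X \<in> borel_measurable borel" "m n \<in> borel_measurable borel" for n
    unfolding m_def[abs_def] X_def[abs_def] by measurable
  have X: "X p \<ge> 1" "X p > 0" for p using S by (auto simp: X_def intro: add_increasing add_nonneg_pos)
  have m: "0 < m n p" "m n p \<le> 1" for n p using X l(1)[of n] by (auto simp: m_def)
  have Xbd: "X p powr (5 + 2 * a) \<le> (2 * S) powr (5 + 2 * a) * weight (5 / 2 + a) r2 p" for p
  proof -
    have "X p \<le> 2 * S * max 1 \<bar>fst p\<bar>"
    proof (cases "\<bar>fst p\<bar> \<le> 1")
      case False
      then have "S * 1 \<le> S * \<bar>fst p\<bar>"
        using S by (intro mult_left_mono) auto
      moreover have "1 * \<bar>fst p\<bar> \<le> S * \<bar>fst p\<bar>"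
        using S by (intro mult_right_mono) auto
      ultimately show ?thesis using False by (simp add: X_def)
    qed (use S in \<open>simp add: X_def\<close>)
    then have "X p powr (5 + 2 * a) \<le> (2 * S * max 1 \<bar>fst p\<bar>) powr (5 + 2 * a)"
      using X[of p] a by (intro powr_mono2) auto
    also have "\<dots> = (2 * S) powr (5 + 2 * a) * (max 1 \<bar>fst p\<bar>) powr (5 + 2 * a)"
      using S by (simp add: powr_mult)
    also have "\<dots> \<le> (2 * S) powr (5 + 2 * a) * weight (5 / 2 + a) r2 p"
      by (intro mult_left_mono)
        (auto simp: weight_def max_def add_increasing add_increasing2 algebra_simps)
    finally show ?thesis .
  qed
  \<comment> \<open>The powers of \<open>X\<close> cancel and those of \<open>m\<close> add up to
    \<open>(1 - a) / 2 + (5 + a) / 2 = 3\<close>. Only \<open>F\<close> involves \<open>f\<close>,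
    and its norm tends to 0 by dominated convergence; \<open>G\<close> carries the exact rate in
    \<open>l\<close>.\<close>
  define F G where "F n p = f p * (X p powr ((5 + 2 * a) / 2) * m n p powr ((1 - a) / 2))"
    and "G n p = X p powr - ((5 + 2 * a) / 2) * m n p powr ((5 + a) / 2) / (1 + \<bar>snd p\<bar>)" for n p
  have [measurable]: "F n \<in> borel_measurable borel" "G n \<in> borel_measurable borel" for n
    unfolding F_def[abs_def] G_def[abs_def] by measurable
  have half: "(z powr (b / 2))\<^sup>2 = z powr b" for z b :: real
    by (simp add: power2_eq_square powr_add[symmetric])
  have F2: "(F n p)\<^sup>2 = X p powr (5 + 2 * a) * m n p powr (1 - a) * (f p)\<^sup>2" for n p
    by (simp add: F_def power_mult_distrib half)
  have FG: "F n p * G n p = f p * (m n p ^ 3 / (1 + \<bar>snd p\<bar>))" for n p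
  proof -
    have "X p powr ((5 + 2 * a) / 2) * X p powr - ((5 + 2 * a) / 2) = 1"
      using X[of p] by (simp add: powr_add[symmetric])
    moreover have "m n p powr ((1 - a) / 2) * m n p powr ((5 + a) / 2) = m n p ^ 3"
      using m[of n p] by (simp add: powr_add[symmetric] add_divide_distrib[symmetric] powr_numeral)
    moreover have "F n p * G n p = f p * ((X p powr ((5 + 2 * a) / 2) * X p powr - ((5 + 2 * a) / 2))
        * (m n p powr ((1 - a) / 2) * m n p powr ((5 + a) / 2)) / (1 + \<bar>snd p\<bar>))"
      by (simp only: F_def G_def times_divide_eq_right mult_ac)
    ultimately show ?thesis by simp
  qed
  have dom: "integrable lborel (\<lambda>p. X p powr (5 + 2 * a) * (f p)\<^sup>2)"
    by (rule weightL2_dominated(1)[OF f]) (use Xbd in auto)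
  have mp: "m n p powr (1 - a) \<le> 1" for n p
    using m[of n p] a by (simp add: powr_le1)
  have Fbd: "norm ((F n p)\<^sup>2) \<le> X p powr (5 + 2 * a) * (f p)\<^sup>2" for n p
    unfolding F2 using mp[of n p]
    by (simp add: abs_mult mult_left_le mult_right_mono)
  have iF: "integrable lborel (\<lambda>p. (F n p)\<^sup>2)" for n
    by (rule Bochner_Integration.integrable_bound[OF dom])
      (use Fbd in \<open>auto intro: order_trans[OF _ abs_ge_self]\<close>)
  have limF: "(\<lambda>n. LINT p|lborel. (F n p)\<^sup>2) \<longlonglongrightarrow> (LINT p::real \<times> real|lborel. 0)"
  proof (rule integral_dominated_convergence[OF _ _ dom])
    have "(\<lambda>n. (F n p)\<^sup>2) \<longlonglongrightarrow> 0" for p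
    proof -
      have "(\<lambda>n. m n p) \<longlonglongrightarrow> min 1 (0 * X p)"
        unfolding m_def by (intro tendsto_intros l)
      then have "(\<lambda>n. m n p powr (1 - a)) \<longlonglongrightarrow> 0 powr (1 - a)"
        by (intro tendsto_powr' tendsto_const) (simp_all add: a m less_imp_le)
      then have "(\<lambda>n. X p powr (5 + 2 * a) * m n p powr (1 - a) * (f p)\<^sup>2)
          \<longlonglongrightarrow> X p powr (5 + 2 * a) * 0 * (f p)\<^sup>2"
        by (intro tendsto_intros) simp
      then show ?thesis by (simp add: F2)
    qed
    then show "AE p in lborel. (\<lambda>n. (F n p)\<^sup>2) \<longlonglongrightarrow> 0" by simp
  qed (use Fbd in auto)
  define K where "K = (LINT z|lborel. kern a z)"
  define P where "P = (LINT y|lborel. 1 / (1 + (y::real)\<^sup>2))"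
  \<comment> \<open>The majorant of \<open>(G n p)\<^sup>2\<close> in the variable x. Summing over
    both signs of x avoids \<open>\<bar>x\<bar>\<close>: one summand is the wanted value, the other
    is nonnegative, and each is an affine substitution in \<open>kern\<close>.\<close>
  define g where "g n x = l n powr (5 + 2 * a) * (kern a (l n * S + l n * x) + kern a (l n * S + (- l n) * x))"
    for n x
  have ik: "integrable lborel (\<lambda>x. kern a (l n * S + c * x))" if "c \<noteq> 0" for n c
    by (rule lborel_integrable_real_affine[OF integrable_kern[OF a] that])
  have ig: "integrable lborel (g n)" for n
    unfolding g_def[abs_def] using l(1)[of n]
    by (intro integrable_mult_right Bochner_Integration.integrable_add ik) auto
  \<comment> \<open>Each substitution divides by \<open>l n\<close>, so the exponent drops from
    \<open>5 + 2 * a\<close> to \<open>4 + 2 * a\<close>, the square of the critical rate.\<close>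
  have val: "(LINT x|lborel. g n x) = 2 * K * l n powr (4 + 2 * a)" for n
  proof -
    have v: "(LINT x|lborel. kern a (l n * S + c * x)) = K / \<bar>c\<bar>" if "c \<noteq> 0" for c
      using lborel_integral_real_affine[OF that, of "kern a" "l n * S"] that by (simp add: K_def)
    have "(LINT x|lborel. g n x) = l n powr (5 + 2 * a) * (K / l n + K / l n)"
      unfolding g_def[abs_def] using l(1)[of n] v[of "l n"] v[of "- l n"] ik[of "l n" n] ik[of "- l n" n]
      by simp
    also have "l n powr (5 + 2 * a) = l n powr (4 + 2 * a) * l n"
      using l(1)[of n] powr_add[of "l n" "4 + 2 * a" 1] by (simp add: algebra_simps)
    finally show ?thesis using l(1)[of n] by (simp add: field_simps)
  qed
  have G2: "(G n p)\<^sup>2 \<le> g n (fst p) * (1 / (1 + (snd p)\<^sup>2))" for n p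
  proof -
    have "(G n p)\<^sup>2 = X p powr - (5 + 2 * a) * m n p powr (5 + a) / (1 + \<bar>snd p\<bar>)\<^sup>2"
      unfolding G_def minus_divide_left power_divide power_mult_distrib half ..
    also have "X p powr - (5 + 2 * a) * m n p powr (5 + a)
      = l n powr (5 + 2 * a) * ((l n * X p) powr - (5 + 2 * a) * m n p powr (5 + a))"
    proof -
      have "l n powr (5 + 2 * a) * l n powr - (5 + 2 * a) = 1"
        using l(1)[of n] unfolding powr_add[symmetric] by simp
      then show ?thesis
        unfolding powr_mult by (simp only: mult.assoc[symmetric] mult_1_left)
    qed
    also have "(l n * X p) powr - (5 + 2 * a) * m n p powr (5 + a) = kern a (l n * X p)"
      unfolding m_def using l(1)[of n] X[of p] a by (intro kern_eq) auto
    also have "l n powr (5 + 2 * a) * kern a (l n * X p) / (1 + \<bar>snd p\<bar>)\<^sup>2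
      \<le> g n (fst p) / (1 + (snd p)\<^sup>2)"
    proof (rule frac_le)
      show "l n powr (5 + 2 * a) * kern a (l n * X p) \<le> g n (fst p)"
        unfolding g_def
        by (intro mult_left_mono) (auto simp: X_def abs_if algebra_simps kern_nonneg)
      show "0 < 1 + (snd p)\<^sup>2" by (simp add: add_pos_nonneg)
      show "1 + (snd p)\<^sup>2 \<le> (1 + \<bar>snd p\<bar>)\<^sup>2" by (simp add: power2_sum)
    qed (simp add: g_def kern_nonneg)
    finally show ?thesis by simp
  qed
  have it: "integrable lborel (\<lambda>p. g n (fst p) * (1 / (1 + (snd p)\<^sup>2)))" for n
    by (rule integrable_tensor[OF ig integrable_inverse_one_plus_square])
  have iG: "integrable lborel (\<lambda>p. (G n p)\<^sup>2)" for n
  proof (rule Bochner_Integration.integrable_bound[OF it])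
    show "AE p in lborel. norm ((G n p)\<^sup>2) \<le> norm (g n (fst p) * (1 / (1 + (snd p)\<^sup>2)))"
      unfolding real_norm_def abs_power2 by (intro AE_I2 order_trans[OF G2 abs_ge_self])
  qed simp
  have GP: "(LINT p|lborel. (G n p)\<^sup>2) \<le> 2 * K * P * l n powr (4 + 2 * a)" for n
  proof -
    have "(LINT p|lborel. (G n p)\<^sup>2) \<le> (LINT p|lborel. g n (fst p) * (1 / (1 + (snd p)\<^sup>2)))"
      by (rule integral_mono[OF iG it G2])
    also have "\<dots> = 2 * K * l n powr (4 + 2 * a) * P"
      unfolding integral_tensor[OF ig integrable_inverse_one_plus_square] val P_def by simp
    finally show ?thesis by (simp add: mult_ac)
  qed
  define I where "I n = (LINT p|lborel. \<bar>f p\<bar> * (m n p ^ 3 / (1 + \<bar>snd p\<bar>)))" for n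
  have I: "(I n / l n powr (2 + a))\<^sup>2 \<le> (LINT p|lborel. (F n p)\<^sup>2) * (2 * K * P)" for n
  proof -
    have "I n = (LINT p|lborel. \<bar>F n p * G n p\<bar>)"
      unfolding I_def FG using m[of n] by (simp add: abs_mult less_imp_le)
    then have "(I n)\<^sup>2 \<le> (LINT p|lborel. (F n p)\<^sup>2) * (LINT p|lborel. (G n p)\<^sup>2)"
      using Cauchy_Schwarz_integral(2)[OF _ _ iF[of n] iG[of n]] by simp
    also have "\<dots> \<le> (LINT p|lborel. (F n p)\<^sup>2) * (2 * K * P * l n powr (4 + 2 * a))"
      by (intro mult_left_mono GP) simp
    also have "l n powr (4 + 2 * a) = (l n powr (2 + a))\<^sup>2"
      by (simp add: power2_eq_square powr_add[symmetric])
    finally show ?thesis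
      using l(1)[of n] by (simp add: power_divide divide_le_eq mult_ac)
  qed
  have "(\<lambda>n. (I n / l n powr (2 + a))\<^sup>2) \<longlonglongrightarrow> 0"
  proof (rule tendsto_sandwich[OF _ _ tendsto_const])
    show "(\<lambda>n. (LINT p|lborel. (F n p)\<^sup>2) * (2 * K * P)) \<longlonglongrightarrow> 0"
      using tendsto_mult_right[OF limF, of "2 * K * P"] by simp
  qed (use I in auto)
  then have "(\<lambda>n. I n / l n powr (2 + a)) \<longlonglongrightarrow> 0" by simp
  then show ?thesis by (simp add: I_def m_def X_def)
qed

section \<open>Third differences of the Fourier transform\<close>

lemma cis_measurable [measurable]: "cis \<in> borel_measurable borel"
  by (intro borel_measurable_continuous_onI continuous_intros)

lemma integrable_cis_mult:
  assumes "integrable lborel (f :: 'a::euclidean_space \<Rightarrow> real)" and [measurable]: "\<theta> \<in> borel_measurable borel"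
  shows "integrable lborel (\<lambda>p. cis (\<theta> p) * complex_of_real (f p))"
proof (rule Bochner_Integration.integrable_bound[OF assms(1)])
  have [measurable]: "f \<in> borel_measurable borel" using assms by auto
  show "(\<lambda>p. cis (\<theta> p) * complex_of_real (f p)) \<in> borel_measurable lborel" by measurable
qed (simp add: norm_mult)

text \<open>Multiplying by \<open>cis (- (\<xi> * \<eta>\<^sup>2 * t))\<close> removes the term \<open>u\<^sub>x\<^sub>y\<^sub>y\<close> from the equation.\<close>

definition twisted :: "(real \<times> real \<Rightarrow> real) \<Rightarrow> real \<Rightarrow> real \<Rightarrow> real \<Rightarrow> complex" where
  "twisted f t \<xi> \<eta> = cis (- (\<xi> * (\<eta>\<^sup>2 * t))) * fourier2 f \<xi> \<eta>"

context
  fixes f :: "real \<times> real \<Rightarrow> real"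
  assumes f: "integrable lborel f"
begin

lemma integrable_twisted:
  "integrable lborel (\<lambda>p. cis (- (\<xi> * (fst p + \<eta>\<^sup>2 * t))) * (cis (- (snd p * \<eta>)) * complex_of_real (f p)))"
proof -
  have "integrable lborel (\<lambda>p. cis (- (\<xi> * (fst p + \<eta>\<^sup>2 * t)) - snd p * \<eta>) * complex_of_real (f p))"
    by (rule integrable_cis_mult[OF f]) measurable
  then show ?thesis by (simp add: mult.assoc[symmetric] cis_mult)
qed

text \<open>The twist translates x by \<open>\<eta>\<^sup>2 * t\<close> under the integral, so the
  stencil in \<xi> acts on a pure character.\<close>

lemma twisted_eq:
  "twisted f t \<xi> \<eta>
    = (LINT p|lborel. cis (- (\<xi> * (fst p + \<eta>\<^sup>2 * t))) * (cis (- (snd p * \<eta>)) * complex_of_real (f p)))"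
proof -
  have "twisted f t \<xi> \<eta> = (LINT p|lborel. cis (- (\<xi> * (\<eta>\<^sup>2 * t))) *
      (cis (- (fst p * \<xi> + snd p * \<eta>)) * complex_of_real (f p)))"
    by (simp add: twisted_def fourier2_def)
  also have "\<dots> = (LINT p|lborel. cis (- (\<xi> * (fst p + \<eta>\<^sup>2 * t))) * (cis (- (snd p * \<eta>)) * complex_of_real (f p)))"
    unfolding mult.assoc[symmetric] cis_mult by (simp add: algebra_simps)
  finally show ?thesis .
qed

lemma stencil_twisted:
  "stencil (\<lambda>\<xi>. twisted f t \<xi> \<eta>) l = (LINT p|lborel.
    \<i> * complex_of_real (symb (l * (fst p + \<eta>\<^sup>2 * t))) * (cis (- (snd p * \<eta>)) * complex_of_real (f p)))"
  unfolding twisted_eq integral_stencil[OF integrable_twisted] stencil_mult_right stencil_cis ..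

text \<open>Meant for \<open>f\<close> equal to the square of the solution: the factor \<xi> in
  front of the nonlinearity reduces the requirement to a second moment. The constant is 4 from the
  stencil times 10 from the cosines.\<close>

lemma stencil_mult_twisted_bound:
  assumes l: "0 < l" and S: "\<bar>\<eta>\<^sup>2 * t\<bar> \<le> S" and int: "integrable lborel (\<lambda>p. (\<bar>fst p\<bar> + S)\<^sup>2 * \<bar>f p\<bar>)"
  shows "cmod (stencil (\<lambda>\<xi>. complex_of_real \<xi> * twisted f t \<xi> \<eta>) l)
    \<le> 40 * l ^ 3 * (LINT p|lborel. (\<bar>fst p\<bar> + S)\<^sup>2 * \<bar>f p\<bar>)"
proof -
  let ?h = "\<lambda>p. complex_of_real (4 * l * (cos (2 * (l * (fst p + \<eta>\<^sup>2 * t))) - cos (l * (fst p + \<eta>\<^sup>2 * t))))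
      * (cis (- (snd p * \<eta>)) * complex_of_real (f p))"
  have "stencil (\<lambda>\<xi>. complex_of_real \<xi> * twisted f t \<xi> \<eta>) l = (LINT p|lborel. stencil (\<lambda>\<xi>.
      complex_of_real \<xi> * (cis (- (\<xi> * (fst p + \<eta>\<^sup>2 * t))) * (cis (- (snd p * \<eta>)) * complex_of_real (f p)))) l)"
    unfolding twisted_eq integral_mult_right_zero[symmetric]
    by (rule integral_stencil) (intro integrable_mult_right integrable_twisted)
  also have "\<dots> = (LINT p|lborel. ?h p)"
    by (simp only: mult.assoc[symmetric] stencil_mult_right stencil_mult_cis)
  finally have eq: "stencil (\<lambda>\<xi>. complex_of_real \<xi> * twisted f t \<xi> \<eta>) l = (LINT p|lborel. ?h p)" .
  have "cmod (LINT p|lborel. ?h p) \<le> (LINT p|lborel. 40 * l ^ 3 * ((\<bar>fst p\<bar> + S)\<^sup>2 * \<bar>f p\<bar>))"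
  proof (rule Bochner_Integration.integral_norm_bound_integral)
    have bd: "cmod (?h p) \<le> 40 * l ^ 3 * ((\<bar>fst p\<bar> + S)\<^sup>2 * \<bar>f p\<bar>)" for p
    proof -
      have "\<bar>l * (fst p + \<eta>\<^sup>2 * t)\<bar> \<le> l * (\<bar>fst p\<bar> + S)"
      proof -
        have "\<bar>fst p + \<eta>\<^sup>2 * t\<bar> \<le> \<bar>fst p\<bar> + S" using S by linarith
        then show ?thesis using l by (simp add: abs_mult)
      qed
      from abs_cos_double_minus_cos_le[OF this]
      have "4 * l * \<bar>cos (2 * (l * (fst p + \<eta>\<^sup>2 * t))) - cos (l * (fst p + \<eta>\<^sup>2 * t))\<bar> * \<bar>f p\<bar>
        \<le> 4 * l * (10 * (l * (\<bar>fst p\<bar> + S))\<^sup>2) * \<bar>f p\<bar>"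
        using l by (intro mult_right_mono mult_left_mono) auto
      moreover have "cmod (?h p) = 4 * l * \<bar>cos (2 * (l * (fst p + \<eta>\<^sup>2 * t))) - cos (l * (fst p + \<eta>\<^sup>2 * t))\<bar> * \<bar>f p\<bar>"
        unfolding norm_mult norm_of_real norm_cis using l by (simp add: abs_mult)
      ultimately show ?thesis
        by (simp add: power2_eq_square power3_eq_cube mult_ac)
    qed
    show int': "integrable lborel (\<lambda>p. 40 * l ^ 3 * ((\<bar>fst p\<bar> + S)\<^sup>2 * \<bar>f p\<bar>))"
      using int by simp
    have [measurable]: "f \<in> borel_measurable borel" using f by auto
    show "integrable lborel ?h"
    proof (rule Bochner_Integration.integrable_bound[OF int'])
      show "?h \<in> borel_measurable lborel" by measurable
    qed (unfold real_norm_def, intro AE_I2 order_trans[OF bd abs_ge_self])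
    show "cmod (?h p) \<le> 40 * l ^ 3 * ((\<bar>fst p\<bar> + S)\<^sup>2 * \<bar>f p\<bar>)" for p by (rule bd)
  qed
  then show ?thesis unfolding eq integral_mult_right_zero .
qed

text \<open>A modulus of continuity in \<xi> at 0, over the range
  \<open>\<bar>\<xi>\<bar> \<le> 2 * l\<close> sampled by the stencil. The right-hand side involves
  \<eta> and \<open>t\<close> only through \<open>S\<close> and has the shape required by
  \<open>weightL2_pairing\<close>.\<close>

lemma twisted_diff_bound:
  fixes l S \<eta> t \<xi> :: real
  assumes l: "0 < l" and S: "\<bar>\<eta>\<^sup>2 * t\<bar> \<le> S" and \<xi>: "\<bar>\<xi>\<bar> \<le> 2 * l"
  shows "cmod (twisted f t \<xi> \<eta> - fourier2 f 0 \<eta>)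
    \<le> 2 * (LINT p :: real \<times> real|lborel. \<bar>min 1 (l * (\<bar>fst p\<bar> + S)) * f p\<bar>)"
proof -
  have [measurable]: "f \<in> borel_measurable borel" using f by auto
  let ?g = "\<lambda>p::real \<times> real. cis (- (\<xi> * (fst p + \<eta>\<^sup>2 * t))) * (cis (- (snd p * \<eta>)) * complex_of_real (f p))"
  have S0: "S \<ge> 0" using S abs_ge_zero order_trans by blast
  have c: "integrable lborel (\<lambda>p. cis (- (snd p * \<eta>)) * complex_of_real (f p))"
    by (rule integrable_cis_mult[OF f]) measurable
  have eq: "twisted f t \<xi> \<eta> - fourier2 f 0 \<eta> = (LINT p|lborel. ?g p - cis (- (snd p * \<eta>)) * complex_of_real (f p))"
    using c integrable_twisted[of \<xi> \<eta> t] by (simp add: twisted_eq fourier2_def)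
  have "cmod (LINT p|lborel. ?g p - cis (- (snd p * \<eta>)) * complex_of_real (f p)) \<le> (LINT p|lborel. 2 * \<bar>min 1 (l * (\<bar>fst p\<bar> + S)) * f p\<bar>)"
  proof (rule Bochner_Integration.integral_norm_bound_integral)
    show "integrable lborel (\<lambda>p. ?g p - cis (- (snd p * \<eta>)) * complex_of_real (f p))"
      using c integrable_twisted[of \<xi> \<eta> t] by simp
    show "integrable lborel (\<lambda>p. 2 * \<bar>min 1 (l * (\<bar>fst p\<bar> + S)) * f p\<bar>)"
    proof (rule integrable_mult_right, rule Bochner_Integration.integrable_bound[OF f])
      show "(\<lambda>p. \<bar>min 1 (l * (\<bar>fst p\<bar> + S)) * f p\<bar>) \<in> borel_measurable lborel" by measurable
    qed (use l S0 in \<open>auto simp: abs_mult mult_left_le_one_le\<close>)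
    fix p :: "real \<times> real"
    have "\<bar>\<xi>\<bar> * \<bar>fst p + \<eta>\<^sup>2 * t\<bar> \<le> (2 * l) * (\<bar>fst p\<bar> + S)"
      using \<xi> S l by (intro mult_mono) auto
    then have "\<bar>- (\<xi> * (fst p + \<eta>\<^sup>2 * t))\<bar> \<le> 2 * (l * (\<bar>fst p\<bar> + S))"
      by (simp add: abs_mult)
    from norm_cis_minus_one_le[OF this]
    have "cmod (cis (- (\<xi> * (fst p + \<eta>\<^sup>2 * t))) - 1) * \<bar>f p\<bar> \<le> 2 * min 1 (l * (\<bar>fst p\<bar> + S)) * \<bar>f p\<bar>"
      by (rule mult_right_mono) simp
    moreover have "?g p - cis (- (snd p * \<eta>)) * complex_of_real (f p)
        = (cis (- (\<xi> * (fst p + \<eta>\<^sup>2 * t))) - 1) * (cis (- (snd p * \<eta>)) * complex_of_real (f p))"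
      by (simp add: algebra_simps)
    moreover have "min 1 (l * (\<bar>fst p\<bar> + S)) \<ge> 0" using l S0 by auto
    ultimately show "cmod (?g p - cis (- (snd p * \<eta>)) * complex_of_real (f p))
        \<le> 2 * \<bar>min 1 (l * (\<bar>fst p\<bar> + S)) * f p\<bar>"
      by (simp add: norm_mult abs_mult)
  qed
  then show ?thesis unfolding eq integral_mult_right_zero .
qed

lemma continuous_fourier2_0: "continuous_on UNIV (\<lambda>\<eta>. fourier2 f 0 \<eta>)"
proof (rule continuous_on_sequentiallyI)
  have [measurable]: "f \<in> borel_measurable borel" using f by auto
  fix e :: "nat \<Rightarrow> real" and \<eta> assume e: "e \<longlonglongrightarrow> \<eta>"
  show "(\<lambda>n. fourier2 f 0 (e n)) \<longlonglongrightarrow> fourier2 f 0 \<eta>"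
    unfolding fourier2_def
  proof (rule integral_dominated_convergence[where w = "\<lambda>p. \<bar>f p\<bar>"])
    show "AE p in lborel. (\<lambda>n. cis (- (fst p * 0 + snd p * e n)) * complex_of_real (f p))
        \<longlonglongrightarrow> cis (- (fst p * 0 + snd p * \<eta>)) * complex_of_real (f p)"
      unfolding cis_conv_exp by (intro AE_I2 tendsto_intros e)
  qed (use f in \<open>auto simp: norm_mult\<close>)
qed

text \<open>Fubini moves the average over \<eta> inside, onto the explicit kernel, where
  \<open>kernel_bound\<close> applies for each point \<open>p\<close>. Integrability in \<eta> also
  comes from Fubini.\<close>

lemma averaged_stencil_bound:
  fixes \<alpha> \<beta> t l S B :: real
  assumes ab: "\<alpha> \<le> \<beta>" and l: "0 < l" "l \<le> 1" and S: "S \<ge> 1"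
    and B: "\<And>\<eta>. \<eta> \<in> {\<alpha>..\<beta>} \<Longrightarrow> \<eta>\<^sup>2 * \<bar>t\<bar> \<le> S" "\<And>\<eta>. \<eta> \<in> {\<alpha>..\<beta>} \<Longrightarrow> 2 * \<bar>\<eta>\<bar> * \<bar>t\<bar> \<le> B"
  shows "(\<lambda>\<eta>. stencil (\<lambda>\<xi>. twisted f t \<xi> \<eta>) l) integrable_on {\<alpha>..\<beta>}"
    and "cmod (integral {\<alpha>..\<beta>} (\<lambda>\<eta>. stencil (\<lambda>\<xi>. twisted f t \<xi> \<eta>) l))
    \<le> (8 * (\<beta> - \<alpha>) + 16 + 12 * B * (\<beta> - \<alpha>)) *
      (LINT p|lborel. \<bar>f p\<bar> * ((min 1 (l * (\<bar>fst p\<bar> + S))) ^ 3 / (1 + \<bar>snd p\<bar>)))"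
proof -
  have [measurable]: "f \<in> borel_measurable borel" using f by auto
  have symb_cont: "continuous_on UNIV symb"
    unfolding symb_def[abs_def] by (intro continuous_intros)
  define C where "C = 8 * (\<beta> - \<alpha>) + 16 + 12 * B * (\<beta> - \<alpha>)"
  define k where "k \<eta> p = cis (- (snd p * \<eta>)) * complex_of_real (symb (l * (fst p + \<eta>\<^sup>2 * t)))"
    for \<eta> and p :: "real \<times> real"
  define h where "h \<eta> p = indicator {\<alpha>..\<beta>} \<eta> *\<^sub>R (\<i> * complex_of_real (f p) * k \<eta> p)" for \<eta> p
  have h: "integrable (lborel \<Otimes>\<^sub>M lborel) (\<lambda>(\<eta>, p). h \<eta> p)"
  proof (rule Bochner_Integration.integrable_bound)
    \<comment> \<open>The number 8 bounds \<open>\<bar>symb \<theta>\<bar>\<close>.\<close>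
    have "integrable lborel (\<lambda>q :: real \<times> real \<times> real. (8 * indicator {\<alpha>..\<beta>} (fst q)) * \<bar>f (snd q)\<bar>)"
      by (intro integrable_tensor integrable_mult_right integrable_real_indicator) (use f ab in auto)
    then show "integrable (lborel \<Otimes>\<^sub>M lborel) (\<lambda>q :: real \<times> real \<times> real. (8 * indicator {\<alpha>..\<beta>} (fst q)) * \<bar>f (snd q)\<bar>)"
      by (simp add: lborel_prod)
    have [measurable]: "(\<lambda>q. k (fst q) (snd q)) \<in> borel_measurable borel"
      unfolding k_def
      by (intro borel_measurable_continuous_onI continuous_intros continuous_on_compose2[OF symb_cont]) auto
    have "(\<lambda>q. h (fst q) (snd q)) \<in> borel_measurable borel"
      unfolding h_def by measurable
    then show "(\<lambda>(\<eta>, p). h \<eta> p) \<in> borel_measurable (lborel \<Otimes>\<^sub>M lborel)"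
      by (simp add: lborel_prod case_prod_unfold)
    have "\<bar>symb \<theta>\<bar> \<le> 8" for \<theta>
      using abs_symb_le[OF order_refl, of \<theta>] power_le_one[of "min 1 \<bar>\<theta>\<bar>" 3] by simp
    then have "cmod (h \<eta> p) \<le> 8 * indicator {\<alpha>..\<beta>} \<eta> * \<bar>f p\<bar>" for \<eta> p
      by (auto simp: h_def k_def norm_mult indicator_def mult.commute[of "\<bar>f p\<bar>"] intro!: mult_right_mono)
    then show "AE q in lborel \<Otimes>\<^sub>M lborel. norm (case q of (\<eta>, p) \<Rightarrow> h \<eta> p)
        \<le> norm (8 * indicator {\<alpha>..\<beta>} (fst q) * \<bar>f (snd q)\<bar>)"
      by (intro AE_I2) (auto simp: case_prod_unfold intro: order_trans[OF _ abs_ge_self])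
  qed
  have inner: "(LINT p|lborel. h \<eta> p) = indicator {\<alpha>..\<beta>} \<eta> *\<^sub>R stencil (\<lambda>\<xi>. twisted f t \<xi> \<eta>) l" for \<eta>
    unfolding h_def stencil_twisted k_def
    by (simp add: mult_ac)
  have set_int: "set_integrable lborel {\<alpha>..\<beta>} (\<lambda>\<eta>. stencil (\<lambda>\<xi>. twisted f t \<xi> \<eta>) l)"
    using lborel_pair.integrable_fst[OF h] unfolding inner set_integrable_def .
  then show "(\<lambda>\<eta>. stencil (\<lambda>\<xi>. twisted f t \<xi> \<eta>) l) integrable_on {\<alpha>..\<beta>}"
    by (rule set_borel_integral_eq_integral)
  have outer: "(LINT \<eta>|lborel. h \<eta> p) = \<i> * complex_of_real (f p) * integral {\<alpha>..\<beta>} (\<lambda>\<eta>. k \<eta> p)" for p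
  proof -
    have "set_integrable lborel {\<alpha>..\<beta>} (\<lambda>\<eta>. k \<eta> p)"
      unfolding set_integrable_def k_def
      by (intro borel_integrable_compact continuous_intros continuous_on_compose2[OF symb_cont]) auto
    from set_borel_integral_eq_integral(2)[OF this]
    have "(LINT \<eta>|lborel. indicator {\<alpha>..\<beta>} \<eta> *\<^sub>R k \<eta> p) = integral {\<alpha>..\<beta>} (\<lambda>\<eta>. k \<eta> p)"
      by (simp add: set_lebesgue_integral_def)
    moreover have "h \<eta> p = (\<i> * complex_of_real (f p)) * (indicator {\<alpha>..\<beta>} \<eta> *\<^sub>R k \<eta> p)" for \<eta>
      by (simp add: h_def)
    ultimately show ?thesis by (simp only: integral_mult_right_zero)
  qed
  have "integral {\<alpha>..\<beta>} (\<lambda>\<eta>. stencil (\<lambda>\<xi>. twisted f t \<xi> \<eta>) l) = (LINT \<eta>|lborel. (LINT p|lborel. h \<eta> p))"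
    using set_borel_integral_eq_integral(2)[OF set_int] by (simp add: set_lebesgue_integral_def inner)
  also have "\<dots> = (LINT p|lborel. (LINT \<eta>|lborel. h \<eta> p))"
    by (rule lborel_pair.Fubini_integral[OF h, symmetric])
  finally have eq: "integral {\<alpha>..\<beta>} (\<lambda>\<eta>. stencil (\<lambda>\<xi>. twisted f t \<xi> \<eta>) l)
    = (LINT p|lborel. (LINT \<eta>|lborel. h \<eta> p))" .
  have "cmod (LINT p|lborel. (LINT \<eta>|lborel. h \<eta> p)) \<le> (LINT p|lborel. C * (\<bar>f p\<bar> * ((min 1 (l * (\<bar>fst p\<bar> + S))) ^ 3 / (1 + \<bar>snd p\<bar>))))"
  proof (rule Bochner_Integration.integral_norm_bound_integral)
    show "integrable lborel (\<lambda>p. LINT \<eta>|lborel. h \<eta> p)"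
      by (rule lborel_pair.integrable_snd[OF h])
    show "integrable lborel (\<lambda>p. C * (\<bar>f p\<bar> * ((min 1 (l * (\<bar>fst p\<bar> + S))) ^ 3 / (1 + \<bar>snd p\<bar>))))"
    proof (rule integrable_mult_right, rule Bochner_Integration.integrable_bound[OF f])
      have "0 \<le> min 1 (l * (\<bar>x\<bar> + S))" "min 1 (l * (\<bar>x\<bar> + S)) \<le> 1" for x
        using l S by auto
      then have "\<bar>min 1 (l * (\<bar>x\<bar> + S)) ^ 3\<bar> \<le> 1 + \<bar>y\<bar>" for x y
        using power_le_one[of "min 1 (l * (\<bar>x\<bar> + S))" 3] by (simp add: add_increasing2)
      then have "\<bar>min 1 (l * (\<bar>x\<bar> + S)) ^ 3 / (1 + \<bar>y\<bar>)\<bar> \<le> 1" for x y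
        unfolding abs_divide by (simp add: divide_le_eq)
      then show "AE p in lborel. norm (\<bar>f p\<bar> * ((min 1 (l * (\<bar>fst p\<bar> + S))) ^ 3 / (1 + \<bar>snd p\<bar>))) \<le> norm (f p)"
        unfolding real_norm_def abs_mult abs_idempotent by (intro AE_I2 mult_left_le) auto
    qed measurable
    fix p
    have "cmod (LINT \<eta>|lborel. h \<eta> p) = \<bar>f p\<bar> * cmod (integral {\<alpha>..\<beta>} (\<lambda>\<eta>. k \<eta> p))"
      by (simp add: outer norm_mult)
    also have "\<dots> \<le> \<bar>f p\<bar> * (C * (min 1 (l * (\<bar>fst p\<bar> + S))) ^ 3 / (1 + \<bar>snd p\<bar>))"
      unfolding k_def C_def by (intro mult_left_mono kernel_bound ab l S B) auto
    finally show "cmod (LINT \<eta>|lborel. h \<eta> p)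
        \<le> C * (\<bar>f p\<bar> * ((min 1 (l * (\<bar>fst p\<bar> + S))) ^ 3 / (1 + \<bar>snd p\<bar>)))"
      by (simp add: mult_ac)
  qed
  then show "cmod (integral {\<alpha>..\<beta>} (\<lambda>\<eta>. stencil (\<lambda>\<xi>. twisted f t \<xi> \<eta>) l)) \<le> C *
      (LINT p|lborel. \<bar>f p\<bar> * ((min 1 (l * (\<bar>fst p\<bar> + S))) ^ 3 / (1 + \<bar>snd p\<bar>)))"
    unfolding eq C_def integral_mult_right_zero .
qed

end

section \<open>Evolution of the third difference\<close>

lemma has_vector_derivative_stencil:
  assumes "\<And>\<xi>. ((\<lambda>\<tau>. g \<tau> \<xi>) has_vector_derivative g' \<xi>) F"
  shows "((\<lambda>\<tau>. stencil (g \<tau>) l) has_vector_derivative stencil g' l) F"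
  unfolding stencil_def
  by (intro has_vector_derivative_add has_vector_derivative_diff has_vector_derivative_mult_right assms)

lemma cmod_stencil_le:
  assumes "cmod (f (2 * l)) \<le> A" "cmod (f (- (2 * l))) \<le> A" "cmod (f l) \<le> B" "cmod (f (- l)) \<le> B"
  shows "cmod (stencil f l) \<le> 2 * A + 4 * B"
proof -
  have "cmod (stencil f l) \<le> cmod (f (2 * l)) + cmod (2 * f l) + cmod (2 * f (- l)) + cmod (f (- (2 * l)))"
    unfolding stencil_def by (smt (verit) norm_triangle_ineq norm_triangle_ineq4)
  also have "\<dots> \<le> A + 2 * B + 2 * B + A"
    unfolding norm_mult norm_numeral by (intro add_mono mult_left_mono assms) auto
  finally show ?thesis by simp
qed

text \<open>The phase is odd and homogeneous of degree \<open>2 + a\<close>: the outer nodes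
  contribute \<open>2 * 2 powr (2 + a)\<close> and the inner ones -4, so nothing cancels for
  positive \<open>a\<close>.\<close>

lemma stencil_phase:
  assumes "0 < l"
  shows "stencil (\<lambda>\<xi>. complex_of_real (\<xi> * \<bar>\<xi>\<bar> powr (a + 1))) l
    = complex_of_real ((2 * 2 powr (2 + a) - 4) * l powr (2 + a))"
proof -
  have "x * x powr (a + 1) = x powr (2 + a)" if "x > 0" for x :: real
    using that powr_mult_base[of x "a + 1"] by (simp add: add_ac)
  from this[OF assms] this[of "2 * l"] assms
  have "l * l powr (a + 1) = l powr (2 + a)"
    "2 * l * (2 * l) powr (a + 1) = 2 powr (2 + a) * l powr (2 + a)"
    by (simp_all add: powr_mult)
  then show ?thesis
    using assms by (simp add: stencil_def abs_mult complex_eq_iff algebra_simps)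
qed

lemma twisted_has_vector_derivative:
  assumes "solves_IVP a T \<phi> u" "t \<in> {0..T}"
  shows "((\<lambda>\<tau>. twisted (u \<tau>) \<tau> \<xi> \<eta>) has_vector_derivative
      - (\<i> * complex_of_real (\<xi> * \<bar>\<xi>\<bar> powr (a + 1))) * twisted (u t) t \<xi> \<eta>
      - \<i> / 2 * (complex_of_real \<xi> * twisted (\<lambda>p. (u t p)\<^sup>2) t \<xi> \<eta>)) (at t within {0..T})"
proof -
  have "((\<lambda>\<tau>. cis (- (\<xi> * (\<eta>\<^sup>2 * \<tau>)))) has_vector_derivative
      - (\<i> * complex_of_real (\<xi> * \<eta>\<^sup>2)) * cis (- (\<xi> * (\<eta>\<^sup>2 * t)))) (at t within {0..T})"
    using exp_scaleR_has_vector_derivative_right[of "- (\<i> * complex_of_real (\<xi> * \<eta>\<^sup>2))" t "{0..T}"]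
    by (simp add: cis_conv_exp scaleR_conv_of_real mult_ac)
  moreover have "((\<lambda>\<tau>. fourier2 (u \<tau>) \<xi> \<eta>) has_vector_derivative
      (- (\<i> * complex_of_real (\<xi> * \<bar>\<xi>\<bar> powr (a + 1)) - \<i> * complex_of_real (\<xi> * \<eta>\<^sup>2)) * fourier2 (u t) \<xi> \<eta>
        - (\<i> * complex_of_real (\<xi> / 2)) * fourier2 (\<lambda>p. (u t p)\<^sup>2) \<xi> \<eta>)) (at t within {0..T})"
    using assms unfolding solves_IVP_def by blast
  ultimately show ?thesis
    unfolding twisted_def
    by (rule has_vector_derivative_mult[THEN has_vector_derivative_eq_rhs]) (simp add: algebra_simps)
qed

text \<open>Every term of the equation other than the time derivative is an x-derivative and carries
  a factor \<xi>, so the transform is conserved on the line \<xi> = 0.\<close>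

lemma fourier2_0_constant:
  assumes "solves_IVP a T \<phi> u" "t \<in> {0..T}"
  shows "fourier2 (u t) 0 \<eta> = fourier2 (u 0) 0 \<eta>"
proof -
  have "((\<lambda>\<tau>. fourier2 (u \<tau>) 0 \<eta>) has_vector_derivative 0) (at t within {0..T})"
    if "t \<in> {0..T}" for t
    using twisted_has_vector_derivative[OF assms(1) that, of 0 \<eta>] by (simp add: twisted_def)
  then obtain c where "\<And>t. t \<in> {0..T} \<Longrightarrow> fourier2 (u t) 0 \<eta> = c"
    using has_vector_derivative_zero_constant[of "{0..T}" "\<lambda>\<tau>. fourier2 (u \<tau>) 0 \<eta>"] by auto
  then show ?thesis using assms(2) by auto
qed

text \<open>The mean value inequality, applied after the main term has been removed. What is left of
  the derivative is the linear error from replacing the solution by its value at \<xi> = 0, and the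
  nonlinear term.\<close>

lemma stencil_increment:
  assumes ivp: "solves_IVP a T \<phi> u" and a: "0 < a" "a < 1" and t: "t1 \<in> {0..T}" "t2 \<in> {0..T}" and l: "0 < l"
    and S: "\<And>t. t \<in> {0..T} \<Longrightarrow> \<bar>\<eta>\<^sup>2 * t\<bar> \<le> S"
    and int: "\<And>t. t \<in> {0..T} \<Longrightarrow> integrable lborel (u t)"
    and int2: "\<And>t. t \<in> {0..T} \<Longrightarrow> integrable lborel (\<lambda>p. (u t p)\<^sup>2)"
    and int3: "\<And>t. t \<in> {0..T} \<Longrightarrow> integrable lborel (\<lambda>p. (\<bar>fst p\<bar> + S)\<^sup>2 * (u t p)\<^sup>2)"
    and e: "\<And>t. t \<in> {0..T} \<Longrightarrow> (LINT p|lborel. \<bar>min 1 (l * (\<bar>fst p\<bar> + S)) * u t p\<bar>) \<le> e"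
    and M: "\<And>t. t \<in> {0..T} \<Longrightarrow> (LINT p|lborel. (\<bar>fst p\<bar> + S)\<^sup>2 * (u t p)\<^sup>2) \<le> M"
  shows "cmod (stencil (\<lambda>\<xi>. twisted (u t2) t2 \<xi> \<eta>) l - stencil (\<lambda>\<xi>. twisted (u t1) t1 \<xi> \<eta>) l
      + (t2 - t1) *\<^sub>R (\<i> * complex_of_real ((2 * 2 powr (2 + a) - 4) * l powr (2 + a)) * fourier2 (u 0) 0 \<eta>))
    \<le> (40 * l powr (2 + a) * e + 20 * l ^ 3 * M) * \<bar>t2 - t1\<bar>"
proof -
  define c where "c = fourier2 (u 0) 0 \<eta>"
  define h where "h \<xi> = complex_of_real (\<xi> * \<bar>\<xi>\<bar> powr (a + 1))" for \<xi>
  define v where "v \<tau> \<xi> = twisted (u \<tau>) \<tau> \<xi> \<eta>" for \<tau> \<xi>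
  define N where "N \<tau> \<xi> = complex_of_real \<xi> * twisted (\<lambda>p. (u \<tau> p)\<^sup>2) \<tau> \<xi> \<eta>" for \<tau> \<xi>
  define D where "D = \<i> * stencil h l * c"
  \<comment> \<open>\<open>- D\<close> is the contribution of the phase with the transform frozen at
    its conserved value \<open>c\<close>; adding \<open>\<tau> *\<^sub>R D\<close> cancels
    it.\<close>
  define w where "w \<tau> = stencil (v \<tau>) l + \<tau> *\<^sub>R D" for \<tau>
  define w' where "w' \<tau> = stencil (\<lambda>\<xi>. - (\<i> * h \<xi>) * v \<tau> \<xi> - \<i> / 2 * N \<tau> \<xi>) l + D" for \<tau>
  have deriv: "(w has_derivative (\<lambda>x. x *\<^sub>R w' \<tau>)) (at \<tau> within {0..T})" if \<tau>: "\<tau> \<in> {0..T}" for \<tau>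
  proof -
    have "((\<lambda>\<tau>. stencil (v \<tau>) l) has_vector_derivative
        stencil (\<lambda>\<xi>. - (\<i> * h \<xi>) * v \<tau> \<xi> - \<i> / 2 * N \<tau> \<xi>) l) (at \<tau> within {0..T})"
      unfolding v_def h_def N_def
      by (rule has_vector_derivative_stencil) (rule twisted_has_vector_derivative[OF ivp \<tau>])
    moreover have "((\<lambda>\<tau>. \<tau> *\<^sub>R D) has_vector_derivative D) (at \<tau> within {0..T})"
      unfolding has_vector_derivative_def by (auto intro!: derivative_eq_intros)
    ultimately show ?thesis
      unfolding w_def[abs_def] w'_def has_vector_derivative_def[symmetric]
      by (rule has_vector_derivative_add)
  qed
  have bound: "cmod (w' \<tau>) \<le> 40 * l powr (2 + a) * e + 20 * l ^ 3 * M" if \<tau>: "\<tau> \<in> {0..T}" for \<tau>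
  proof -
    have eq: "w' \<tau> = - \<i> * stencil (\<lambda>\<xi>. h \<xi> * (v \<tau> \<xi> - c)) l - \<i> / 2 * stencil (N \<tau>) l"
      by (simp add: w'_def D_def stencil_def algebra_simps)
    have "cmod (w' \<tau>) \<le> cmod (stencil (\<lambda>\<xi>. h \<xi> * (v \<tau> \<xi> - c)) l) + cmod (stencil (N \<tau>) l) / 2"
      unfolding eq by (rule order_trans[OF norm_triangle_ineq4]) (simp add: norm_mult norm_divide)
    moreover have "cmod (stencil (\<lambda>\<xi>. h \<xi> * (v \<tau> \<xi> - c)) l)
        \<le> 40 * l powr (2 + a) * e"
    proof -
      have vc: "cmod (v \<tau> \<xi> - c) \<le> 2 * e" if "\<bar>\<xi>\<bar> \<le> 2 * l" for \<xi>
        using twisted_diff_bound[OF int[OF \<tau>] l S[OF \<tau>] that] e[OF \<tau>]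
        unfolding v_def c_def fourier2_0_constant[OF ivp \<tau>] by linarith
      have "0 \<le> 2 * e" by (rule order_trans[OF norm_ge_zero vc[of 0]]) (use l in simp)
      then have e0: "0 \<le> e" by simp
      have pow: "x * x powr (a + 1) = x powr (2 + a)" if "x > 0" for x :: real
        using that powr_mult_base[of x "a + 1"] by (simp add: add_ac)
      have h1: "cmod (h l) \<le> l powr (2 + a)" "cmod (h (- l)) \<le> l powr (2 + a)"
        using l pow[OF l] by (simp_all add: h_def norm_mult)
      have "2 powr (2 + a) \<le> (2::real) powr 3" using a by (intro powr_mono) auto
      then have "(2 * l) powr (2 + a) \<le> 8 * l powr (2 + a)"
        unfolding powr_mult by (intro mult_right_mono) auto
      then have h2: "cmod (h (2 * l)) \<le> 8 * l powr (2 + a)" "cmod (h (- (2 * l))) \<le> 8 * l powr (2 + a)"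
        using l pow[of "2 * l"] by (simp_all add: h_def norm_mult)
      \<comment> \<open>The outer nodes give \<open>2 * 8 * 2\<close> and the inner ones
        \<open>4 * 2\<close>, in total 40; the 8 bounds \<open>2 powr (2 + a)\<close> because
        \<open>a < 1\<close>.\<close>
      have "cmod (stencil (\<lambda>\<xi>. h \<xi> * (v \<tau> \<xi> - c)) l)
          \<le> 2 * (8 * l powr (2 + a) * (2 * e)) + 4 * (l powr (2 + a) * (2 * e))"
        by (rule cmod_stencil_le; unfold norm_mult; intro mult_mono h1 h2 vc)
          (use l e0 in auto)
      then show ?thesis by (simp add: algebra_simps)
    qed
    \<comment> \<open>The 20 in the claim is half of this constant, since the nonlinearity is half
      the x-derivative of the square.\<close>
    moreover have "cmod (stencil (N \<tau>) l) \<le> 40 * l ^ 3 * M"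
    proof -
      have "cmod (stencil (N \<tau>) l) \<le> 40 * l ^ 3 * (LINT p|lborel. (\<bar>fst p\<bar> + S)\<^sup>2 * \<bar>(u \<tau> p)\<^sup>2\<bar>)"
        unfolding N_def
        by (rule stencil_mult_twisted_bound[OF int2[OF \<tau>] l S[OF \<tau>]]) (use int3[OF \<tau>] in simp)
      also have "\<dots> \<le> 40 * l ^ 3 * M"
        using M[OF \<tau>] l by (intro mult_left_mono) auto
      finally show ?thesis .
    qed
    ultimately show ?thesis by linarith
  qed
  have "cmod (w t2 - w t1) \<le> (40 * l powr (2 + a) * e + 20 * l ^ 3 * M) * cmod (complex_of_real (t2 - t1))"
    unfolding norm_of_real real_norm_def[symmetric]
    by (rule differentiable_bound[OF _ deriv _ t(2) t(1)])
      (auto intro!: onorm_le simp: mult.commute[of "\<bar>_\<bar>"] intro!: mult_right_mono bound)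
  moreover have "w t2 - w t1 = stencil (v t2) l - stencil (v t1) l + (t2 - t1) *\<^sub>R D"
    by (simp add: w_def algebra_simps)
  moreover have "D = \<i> * complex_of_real ((2 * 2 powr (2 + a) - 4) * l powr (2 + a)) * fourier2 (u 0) 0 \<eta>"
    unfolding D_def c_def h_def stencil_phase[OF l] ..
  ultimately show ?thesis
    unfolding v_def norm_of_real by metis
qed

section \<open>The limit of vanishing step\<close>

text \<open>The cutoff tends to 0 pointwise and stays below 1, so dominated convergence applies.
  This provides the o(1) in the linear error.\<close>

lemma min_pairing_tendsto_0:
  fixes S :: real and l :: "nat \<Rightarrow> real"
  assumes S: "S \<ge> 1" and l: "\<And>n. 0 < l n" "l \<longlonglongrightarrow> 0"
  shows "(\<lambda>n. LINT p|lborel. (min 1 (l n * (\<bar>fst p\<bar> + S)))\<^sup>2 * hprod p) \<longlonglongrightarrow> 0"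
proof -
  have "(\<lambda>n. LINT p|lborel. (min 1 (l n * (\<bar>fst p\<bar> + S)))\<^sup>2 * hprod p)
      \<longlonglongrightarrow> (LINT p :: real \<times> real|lborel. 0)"
  proof (rule integral_dominated_convergence[OF _ _ integrable_hprod])
    show "AE p in lborel. (\<lambda>n. (min 1 (l n * (\<bar>fst p\<bar> + S)))\<^sup>2 * hprod p) \<longlonglongrightarrow> 0"
    proof (rule AE_I2)
      fix p :: "real \<times> real"
      have "(\<lambda>n. (min 1 (l n * (\<bar>fst p\<bar> + S)))\<^sup>2 * hprod p)
          \<longlonglongrightarrow> (min 1 (0 * (\<bar>fst p\<bar> + S)))\<^sup>2 * hprod p"
        by (intro tendsto_intros l)
      then show "(\<lambda>n. (min 1 (l n * (\<bar>fst p\<bar> + S)))\<^sup>2 * hprod p) \<longlonglongrightarrow> 0" by simp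
    qed
    fix n
    have "\<bar>min 1 (l n * (\<bar>x\<bar> + S))\<bar> \<le> 1" for x
      using l(1)[of n] S by auto
    then show "AE p in lborel. norm ((min 1 (l n * (\<bar>fst p\<bar> + S)))\<^sup>2 * hprod p) \<le> hprod p"
      using hprod_pos by (intro AE_I2) (simp add: abs_mult abs_square_le_1 mult_left_le_one_le less_imp_le)
  qed measurable
  then show ?thesis by simp
qed

text \<open>Divide the averaged increment by \<open>l powr (2 + a)\<close>. The stencils at
  \<open>t1\<close> and \<open>t2\<close> vanish in the limit by the decay there, the linear error
  by the uniform modulus \<open>e\<close>, and the nonlinear one because \<open>3 > 2 + a\<close>.
  Only the multiple of the conserved average remains.\<close>

lemma averaged_trace_zero:
  fixes a r1 r2 T t1 t2 \<alpha> \<beta> :: real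
  assumes a: "0 < a" "a < 1" and r: "r1 \<ge> 2" "r2 \<ge> 2"
    and cz: "in_CZ a s r1 r2 T u" and ivp: "solves_IVP a T \<phi> u"
    and t: "t1 \<in> {0..T}" "t2 \<in> {0..T}" "t1 \<noteq> t2"
    and dec: "u t1 \<in> weightL2 (5 / 2 + a) r2" "u t2 \<in> weightL2 (5 / 2 + a) r2"
    and ab: "\<alpha> \<le> \<beta>"
  shows "integral {\<alpha>..\<beta>} (\<lambda>\<eta>. fourier2 (u 0) 0 \<eta>) = 0"
proof -
  have T: "T \<ge> 0" using t(1) by auto
  have mem: "u t \<in> weightL2 r1 r2" if "t \<in> {0..T}" for t
    using cz that by (auto simp: in_CZ_def Zspace_def)
  have int: "integrable lborel (u t)" if "t \<in> {0..T}" for t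
    using weightL2_pairing(1)[OF mem[OF that] r, of "\<lambda>_. 1"] by simp
  have int2: "integrable lborel (\<lambda>p. (u t p)\<^sup>2)" if "t \<in> {0..T}" for t
    using weightL2_dominated(1)[OF mem[OF that], of "\<lambda>_. 1" 1] weight_ge_1[of r1 r2] by simp
  obtain M where M: "weightL2_norm2 r1 r2 (u t) \<le> M" if "t \<in> {0..T}" for t
    using in_CZ_weight_bounded[OF cz] by blast
  define b where "b = max \<bar>\<alpha>\<bar> \<bar>\<beta>\<bar>"
  \<comment> \<open>The summand 1 ensures \<open>S \<ge> 1\<close>; the rest bounds the shift
    \<open>\<eta>\<^sup>2 * t\<close> over the interval and over all times.\<close>
  define S where "S = 1 + b\<^sup>2 * T"
  define B where "B = 2 * b * T"
  have b: "\<bar>\<eta>\<bar> \<le> b" if "\<eta> \<in> {\<alpha>..\<beta>}" for \<eta>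
    using that by (auto simp: b_def)
  have b0: "b \<ge> 0" by (simp add: b_def)
  have S1: "S \<ge> 1" using T by (simp add: S_def)
  have SB: "\<eta>\<^sup>2 * \<bar>t\<bar> \<le> S" "2 * \<bar>\<eta>\<bar> * \<bar>t\<bar> \<le> B" if "\<eta> \<in> {\<alpha>..\<beta>}" "t \<in> {0..T}" for \<eta> t
  proof -
    have "\<eta>\<^sup>2 \<le> b\<^sup>2" using power_mono[OF b[OF that(1)], of 2] by simp
    then have "\<eta>\<^sup>2 * \<bar>t\<bar> \<le> b\<^sup>2 * T" using that(2) by (intro mult_mono) auto
    then show "\<eta>\<^sup>2 * \<bar>t\<bar> \<le> S" by (simp add: S_def)
    have "\<bar>\<eta>\<bar> * \<bar>t\<bar> \<le> b * T" using that(2) b[OF that(1)] b0 by (intro mult_mono) auto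
    then show "2 * \<bar>\<eta>\<bar> * \<bar>t\<bar> \<le> B" by (simp add: B_def)
  qed
  have X2: "\<bar>(\<bar>fst p\<bar> + S)\<^sup>2\<bar> \<le> (4 + 2 * S\<^sup>2) * weight r1 r2 p" for p
  proof -
    have "(\<bar>fst p\<bar> + S)\<^sup>2 \<le> 2 * (fst p)\<^sup>2 + 2 * S\<^sup>2"
      using sum_squares_bound[of "\<bar>fst p\<bar>" S] by (simp add: power2_sum)
    also have "2 * (fst p)\<^sup>2 \<le> 1 + (fst p) ^ 4"
      using sum_squares_bound[of 1 "(fst p)\<^sup>2"] by simp
    also have "(fst p) ^ 4 \<le> 1 + \<bar>fst p\<bar> powr (2 * r1)"
      by (rule fourth_power_le_powr[OF r(1)])
    also have "1 + (1 + \<bar>fst p\<bar> powr (2 * r1)) + 2 * S\<^sup>2 \<le> 4 * weight r1 r2 p + 2 * S\<^sup>2 * weight r1 r2 p"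
    proof (rule add_mono)
      have "1 + (1 + A) \<le> 4 * (1 + A + C)" if "0 \<le> A" "0 \<le> C" for A C :: real
        using that by (simp add: algebra_simps)
      then show "1 + (1 + \<bar>fst p\<bar> powr (2 * r1)) \<le> 4 * weight r1 r2 p"
        by (simp add: weight_def)
      show "2 * S\<^sup>2 \<le> 2 * S\<^sup>2 * weight r1 r2 p"
        using mult_left_mono[OF weight_ge_1, of "2 * S\<^sup>2"] by simp
    qed
    finally show ?thesis by (simp add: algebra_simps)
  qed
  define M' where "M' = (4 + 2 * S\<^sup>2) * M"
  have int3: "integrable lborel (\<lambda>p. (\<bar>fst p\<bar> + S)\<^sup>2 * (u t p)\<^sup>2)"
    and M': "(LINT p|lborel. (\<bar>fst p\<bar> + S)\<^sup>2 * (u t p)\<^sup>2) \<le> M'" if t: "t \<in> {0..T}" for t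
  proof -
    note dom = weightL2_dominated[OF mem[OF t] _ X2]
    show "integrable lborel (\<lambda>p. (\<bar>fst p\<bar> + S)\<^sup>2 * (u t p)\<^sup>2)"
      by (rule dom(1)) measurable
    have "(LINT p|lborel. (\<bar>fst p\<bar> + S)\<^sup>2 * (u t p)\<^sup>2) \<le> (4 + 2 * S\<^sup>2) * weightL2_norm2 r1 r2 (u t)"
      by (rule dom(2)) measurable
    also have "\<dots> \<le> M'" unfolding M'_def using M[OF t] by (intro mult_left_mono) auto
    finally show "(LINT p|lborel. (\<bar>fst p\<bar> + S)\<^sup>2 * (u t p)\<^sup>2) \<le> M'" .
  qed
  define l where "l n = inverse (real (Suc n))" for n
  have l: "0 < l n" "l n \<le> 1" for n by (auto simp: l_def divide_simps)
  have l0: "l \<longlonglongrightarrow> 0" unfolding l_def[abs_def] by (rule LIMSEQ_inverse_real_of_nat)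
  \<comment> \<open>The bound of \<open>weightL2_pairing\<close> with the norm replaced by
    \<open>M\<close>, hence the same for all times.\<close>
  define e where "e n = sqrt (4 * M * (LINT p|lborel. (min 1 (l n * (\<bar>fst p\<bar> + S)))\<^sup>2 * hprod p))" for n
  have e: "(LINT p|lborel. \<bar>min 1 (l n * (\<bar>fst p\<bar> + S)) * u t p\<bar>) \<le> e n" if "t \<in> {0..T}" for t n
  proof -
    have "\<bar>min 1 (l n * (\<bar>x\<bar> + S))\<bar> \<le> 1" for x
      using l(1)[of n] S1 by auto
    then have "(LINT p|lborel. \<bar>min 1 (l n * (\<bar>fst p\<bar> + S)) * u t p\<bar>)\<^sup>2
        \<le> 4 * weightL2_norm2 r1 r2 (u t) * (LINT p|lborel. (min 1 (l n * (\<bar>fst p\<bar> + S)))\<^sup>2 * hprod p)"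
      by (intro weightL2_pairing(2)[OF mem[OF that] r]) auto
    also have "\<dots> \<le> 4 * M * (LINT p|lborel. (min 1 (l n * (\<bar>fst p\<bar> + S)))\<^sup>2 * hprod p)"
      using M[OF that] less_imp_le[OF hprod_pos]
      by (intro mult_right_mono Bochner_Integration.integral_nonneg) auto
    finally show ?thesis unfolding e_def by (rule real_le_rsqrt)
  qed
  have e0: "e \<longlonglongrightarrow> 0"
    using tendsto_real_sqrt[OF tendsto_mult_left[OF min_pairing_tendsto_0[OF S1 l(1) l0]], of "4 * M"]
    by (simp add: e_def[abs_def])
  define C where "C = 8 * (\<beta> - \<alpha>) + 16 + 12 * B * (\<beta> - \<alpha>)"
  define P where "P t n = (LINT p|lborel. \<bar>u t p\<bar> * ((min 1 (l n * (\<bar>fst p\<bar> + S))) ^ 3 / (1 + \<bar>snd p\<bar>)))" for t n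
  define W where "W t n \<eta> = stencil (\<lambda>\<xi>. twisted (u t) t \<xi> \<eta>) (l n)" for t n \<eta>
  have W: "W t n integrable_on {\<alpha>..\<beta>}" "cmod (integral {\<alpha>..\<beta>} (W t n)) \<le> C * P t n" if t: "t \<in> {0..T}" for t n
    unfolding W_def[abs_def] C_def P_def
    by (rule averaged_stencil_bound[OF int[OF t] ab l S1 SB(1)[OF _ t] SB(2)[OF _ t]]; assumption)+
  define \<kappa> where "\<kappa> = 2 * 2 powr (2 + a) - (4::real)"
  have "(2::real) powr 2 < 2 powr (2 + a)" using a by (intro powr_less_mono) auto
  then have \<kappa>: "\<kappa> > 0" by (simp add: \<kappa>_def)
  define c where "c = fourier2 (u 0) 0"
  define I where "I = integral {\<alpha>..\<beta>} c"
  have u0: "integrable lborel (u 0)" using int T by simp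
  have c: "c integrable_on {\<alpha>..\<beta>}"
    unfolding c_def
    by (intro integrable_continuous_interval continuous_on_subset[OF continuous_fourier2_0[OF u0]]) auto
  have main: "\<bar>t2 - t1\<bar> * \<kappa> * cmod I
      \<le> C * (P t2 n / l n powr (2 + a)) + C * (P t1 n / l n powr (2 + a))
        + (40 * e n + 20 * M' * l n powr (1 - a)) * (\<bar>t2 - t1\<bar> * (\<beta> - \<alpha>))" for n
  proof -
    define L where "L = l n powr (2 + a)"
    have L: "L > 0" using l[of n] by (simp add: L_def)
    define z where "z = complex_of_real (t2 - t1) * (\<i> * complex_of_real (\<kappa> * L))"
    define R where "R = (40 * L * e n + 20 * l n ^ 3 * M') * \<bar>t2 - t1\<bar>"
    have pt: "cmod (W t2 n \<eta> - W t1 n \<eta> + z * c \<eta>) \<le> R" if \<eta>: "\<eta> \<in> {\<alpha>..\<beta>}" for \<eta>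
    proof -
      have "\<bar>\<eta>\<^sup>2 * t\<bar> \<le> S" if "t \<in> {0..T}" for t
        using SB(1)[OF \<eta> that] by (simp add: abs_mult)
      from stencil_increment[OF ivp a t(1,2) l(1) this int int2 int3 e M', of n]
      show ?thesis
        by (simp add: W_def z_def c_def \<kappa>_def L_def R_def scaleR_conv_of_real mult.assoc)
    qed
    have hi: "((\<lambda>\<eta>. W t2 n \<eta> - W t1 n \<eta> + z * c \<eta>) has_integral
        integral {\<alpha>..\<beta>} (W t2 n) - integral {\<alpha>..\<beta>} (W t1 n) + z * I) {\<alpha>..\<beta>}"
      unfolding I_def
      by (intro has_integral_add has_integral_diff has_integral_mult_right integrable_integral c W t)
    have R0: "R \<ge> 0"
      by (rule order_trans[OF norm_ge_zero pt[of \<alpha>]]) (use ab in simp)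
    have "cmod (integral {\<alpha>..\<beta>} (W t2 n) - integral {\<alpha>..\<beta>} (W t1 n) + z * I) \<le> R * measure lborel {\<alpha>..\<beta>}"
      by (rule has_integral_bound_real[OF R0 _ hi, of "{}"]) (use pt in auto)
    then have "cmod (integral {\<alpha>..\<beta>} (W t2 n) - integral {\<alpha>..\<beta>} (W t1 n) + z * I) \<le> R * (\<beta> - \<alpha>)"
      using ab by simp
    moreover have "cmod (z * I) \<le> cmod (integral {\<alpha>..\<beta>} (W t2 n) - integral {\<alpha>..\<beta>} (W t1 n) + z * I)
        + cmod (integral {\<alpha>..\<beta>} (W t2 n)) + cmod (integral {\<alpha>..\<beta>} (W t1 n))"
    proof -
      have "cmod w \<le> cmod (x - y + w) + cmod x + cmod y" for w x y
        using norm_triangle_ineq4[of "x - y + w" "x - y"] norm_triangle_ineq4[of x y] by simp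
      then show ?thesis .
    qed
    ultimately have "cmod (z * I) \<le> R * (\<beta> - \<alpha>) + C * P t2 n + C * P t1 n"
      using W(2)[OF t(1), of n] W(2)[OF t(2), of n] by linarith
    moreover have "cmod (z * I) = L * (\<bar>t2 - t1\<bar> * \<kappa> * cmod I)"
      using L \<kappa> unfolding z_def norm_mult norm_of_real by (simp add: abs_mult)
    ultimately have "L * (\<bar>t2 - t1\<bar> * \<kappa> * cmod I) \<le> R * (\<beta> - \<alpha>) + C * P t2 n + C * P t1 n"
      by simp
    \<comment> \<open>The gain \<open>l n powr (1 - a)\<close> over the critical rate is where
      \<open>a < 1\<close> defeats the nonlinear term.\<close>
    moreover have "l n ^ 3 = L * l n powr (1 - a)"
      using l(1)[of n] by (simp add: L_def powr_add[symmetric] powr_numeral)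
    then have "R * (\<beta> - \<alpha>) + C * P t2 n + C * P t1 n = L * (C * (P t2 n / L) + C * (P t1 n / L)
        + (40 * e n + 20 * M' * l n powr (1 - a)) * (\<bar>t2 - t1\<bar> * (\<beta> - \<alpha>)))"
      using L by (simp add: R_def field_simps)
    ultimately show ?thesis
      using L unfolding L_def[symmetric] by (simp only: mult_le_cancel_left_pos)
  qed
  have "(\<lambda>n. P t n / l n powr (2 + a)) \<longlonglongrightarrow> 0" if "u t \<in> weightL2 (5 / 2 + a) r2" for t
    unfolding P_def by (rule critical_pairing_tendsto_0[OF a S1 that l(1) l0])
  note P0 = this[OF dec(1)] this[OF dec(2)]
  have "(\<lambda>n. l n powr (1 - a)) \<longlonglongrightarrow> 0 powr (1 - a)"
    using a by (intro tendsto_powr' l0 tendsto_const) (auto simp: less_imp_le l)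
  then have la: "(\<lambda>n. l n powr (1 - a)) \<longlonglongrightarrow> 0" by simp
  have "(\<lambda>n. C * (P t2 n / l n powr (2 + a)) + C * (P t1 n / l n powr (2 + a))
        + (40 * e n + 20 * M' * l n powr (1 - a)) * (\<bar>t2 - t1\<bar> * (\<beta> - \<alpha>)))
      \<longlonglongrightarrow> C * 0 + C * 0 + (40 * 0 + 20 * M' * 0) * (\<bar>t2 - t1\<bar> * (\<beta> - \<alpha>))"
    by (intro tendsto_intros P0 e0 la)
  \<comment> \<open>The left-hand side does not depend on \<open>n\<close>, so it is bounded by the
    limit of the right-hand sides.\<close>
  then have "\<bar>t2 - t1\<bar> * \<kappa> * cmod I \<le> C * 0 + C * 0 + (40 * 0 + 20 * M' * 0) * (\<bar>t2 - t1\<bar> * (\<beta> - \<alpha>))"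
    by (rule LIMSEQ_le_const) (use main in blast)
  moreover have "\<bar>t2 - t1\<bar> * \<kappa> > 0" using t(3) \<kappa> by simp
  ultimately have "I = 0"
    using t(3) \<kappa> by (simp add: mult_le_0_iff)
  then show ?thesis by (simp add: I_def c_def)
qed

text \<open>The primitive starting at \<alpha> vanishes identically to the right of \<alpha>, and
  its one-sided derivative there is \<open>c \<alpha>\<close>.\<close>

lemma zero_of_integral_zero:
  fixes c :: "real \<Rightarrow> complex"
  assumes cont: "continuous_on UNIV c" and zero: "\<And>\<beta>. \<alpha> \<le> \<beta> \<Longrightarrow> integral {\<alpha>..\<beta>} c = 0"
  shows "c \<alpha> = 0"
proof -
  have "((\<lambda>x. integral {\<alpha>..x} c) has_vector_derivative c \<alpha>) (at \<alpha> within {\<alpha>..\<alpha> + 1})"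
    by (rule integral_has_vector_derivative) (auto intro: continuous_on_subset[OF cont])
  then have "((\<lambda>x. 0) has_vector_derivative c \<alpha>) (at \<alpha> within {\<alpha>..\<alpha> + 1})"
    by (rule has_vector_derivative_transform[rotated 2]) (auto simp: zero)
  moreover have "((\<lambda>x. 0) has_vector_derivative 0) (at \<alpha> within {\<alpha>..\<alpha> + 1})"
    by (rule has_vector_derivative_const)
  ultimately show ?thesis
    using vector_derivative_unique_within_closed_interval[of \<alpha> "\<alpha> + 1" \<alpha> "\<lambda>x. 0" "c \<alpha>" 0] by simp
qed

theorem theorem1p2:
  fixes a s r1 r2 T t1 t2 :: real
    and \<phi> :: "real \<times> real \<Rightarrow> real"
    and u :: "real \<Rightarrow> real \<times> real \<Rightarrow> real"
  assumes "0 < a" and "a < 1" and "s \<ge> 2" and "r1 > 2" and "r2 > 2"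
    and "in_CZ a s r1 r2 T u"
    and "solves_IVP a T \<phi> u"
    and "t1 \<in> {0..T}" and "t2 \<in> {0..T}" and "t1 \<noteq> t2"
    and "u t1 \<in> Zspace a s (5/2 + a) r2"
    and "u t2 \<in> Zspace a s (5/2 + a) r2"
  shows "\<forall>\<eta>. \<forall>t\<in>{0..T}. fourier2 (u t) 0 \<eta> = 0"
proof (intro allI ballI)
  fix \<eta> t :: real
  assume t: "t \<in> {0..T}"
  have dec: "u t1 \<in> weightL2 (5 / 2 + a) r2" "u t2 \<in> weightL2 (5 / 2 + a) r2"
    using assms(11,12) by (auto simp: Zspace_def)
  \<comment> \<open>The existence of \<open>t\<close> in \<open>{0..T}\<close> guarantees that 0 is
    an admissible time.\<close>
  have "u 0 \<in> weightL2 r1 r2"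
    using assms(6) t by (auto simp: in_CZ_def Zspace_def)
  then have "integrable lborel (u 0)"
    using weightL2_pairing(1)[of "u 0" r1 r2 "\<lambda>_. 1"] assms(4,5) by simp
  from continuous_fourier2_0[OF this] have "fourier2 (u 0) 0 \<eta> = 0"
    by (rule zero_of_integral_zero)
      (use averaged_trace_zero[OF assms(1,2) _ _ assms(6-10) dec] assms(4,5) in auto)
  then show "fourier2 (u t) 0 \<eta> = 0"
    using fourier2_0_constant[OF assms(7) t] by simp
qed

end
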